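(* Let $\Phi:\mathbb{M}_n^k\to\mathbb{M}_m$ be a positive multilinear mapping and let $f_1,\dots,f_k$ be operator log-convex functions. Let $F(A_1,\dots,A_k)=\Phi(f_1(A_1),\dots,f_k(A_k))$ for positive definite $A_1,\dots,A_k\in\mathbb{M}_n$. (i) $F$ is jointly log-convex: $F(A_1\nabla B_1,\dots,A_k\nabla B_k)\le F(A_1,\dots,A_k)\,\sharp\,F(B_1,\dots,B_k)$ for all positive definite $A_i,B_i$. (ii) $(A_1,\dots,A_k)\mapsto F(A_1,\dots,A_k)^{-1}$ is jointly log-concave: $F(A_1\nabla B_1,\dots,A_k\nabla B_k)^{-1}\ge F(A_1,\dots,A_k)^{-1}\,\sharp\,F(B_1,\dots,B_k)^{-1}$. (iii) For every convex monotone increasing function $h$, the map $(A_1,\dots,A_k)\mapsto\mathrm{Tr}\{h(\Phi(f_1(A_1),\dots,f_k(A_k)))\}$ is jointly convex.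
   Context: $\mathbb{M}_n$ denotes $n\times n$ complex matrices, $\mathrm{Tr}$ the trace, $\le$ the Löwner order. $\Phi:\mathbb{M}_n^k\to\mathbb{M}_m$ is multilinear if linear in each variable, and positive if $\Phi(A_1,\dots,A_k)$ is positive semidefinite whenever all $A_i$ are. $X\nabla Y=(X+Y)/2$, $X\sharp Y=X^{1/2}(X^{-1/2}YX^{-1/2})^{1/2}X^{1/2}$. The functions $f_i$ are nonnegative continuous on $(0,\infty)$, and $f$ is operator log-convex if $f(X\nabla Y)\le f(X)\sharp f(Y)$ for all positive definite $X,Y$. Jointly convex means $T((1-\lambda)A+\lambda B)\le(1-\lambda)T(A)+\lambda T(B)$ for tuples $A,B$ and $\lambda\in[0,1]$ (operations componentwise).
   Formalization: In (i) F(A) and F(B) are assumed positive definite, and in (ii) also F(A∇B); for a merely positive Φ (e.g. Φ=0) these may be singular, and then ♯ as defined and the inverses do not exist. *)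

theory Defs
  imports "HOL-Analysis.Analysis" "Jordan_Normal_Form.Schur_Decomposition"
begin

definition mtrace :: "complex mat \<Rightarrow> complex" where
  "mtrace A = (\<Sum>i<dim_row A. A $$ (i,i))"

definition hermitian :: "complex mat \<Rightarrow> bool" where
  "hermitian A \<longleftrightarrow> dim_row A = dim_col A \<and> mat_adjoint A = A"

definition unitary :: "complex mat \<Rightarrow> bool" where
  "unitary U \<longleftrightarrow> dim_row U = dim_col U \<and> mat_adjoint U * U = 1\<^sub>m (dim_row U)"

definition psd :: "complex mat \<Rightarrow> bool" where
  "psd A \<longleftrightarrow> hermitian A \<and>
     (\<forall>v \<in> carrier_vec (dim_row A). 0 \<le> Re ((A *\<^sub>v v) \<bullet>c v))"

definition pd :: "complex mat \<Rightarrow> bool" where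
  "pd A \<longleftrightarrow> hermitian A \<and>
     (\<forall>v \<in> carrier_vec (dim_row A). v \<noteq> 0\<^sub>v (dim_row A) \<longrightarrow> 0 < Re ((A *\<^sub>v v) \<bullet>c v))"

definition loewner_le :: "complex mat \<Rightarrow> complex mat \<Rightarrow> bool" where
  "loewner_le A B \<longleftrightarrow> dim_row A = dim_row B \<and> dim_col A = dim_col B \<and> psd (B - A)"

definition minv :: "complex mat \<Rightarrow> complex mat" where
  "minv A = (THE B. B \<in> carrier_mat (dim_row A) (dim_row A) \<and>
                   A * B = 1\<^sub>m (dim_row A) \<and> B * A = 1\<^sub>m (dim_row A))"

definition mfun :: "(real \<Rightarrow> real) \<Rightarrow> complex mat \<Rightarrow> complex mat" where
  "mfun f A = (SOME B. \<exists>U d. unitary U \<and> U \<in> carrier_mat (dim_row A) (dim_row A) \<and>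
      A = U * mat_diag (dim_row A) (\<lambda>i. complex_of_real (d i)) * mat_adjoint U \<and>
      B = U * mat_diag (dim_row A) (\<lambda>i. complex_of_real (f (d i))) * mat_adjoint U)"

definition amean :: "complex mat \<Rightarrow> complex mat \<Rightarrow> complex mat" where
  "amean X Y = (1/2 :: complex) \<cdot>\<^sub>m (X + Y)"

definition gmean :: "complex mat \<Rightarrow> complex mat \<Rightarrow> complex mat" where
  "gmean X Y = mfun sqrt X *
      mfun sqrt (mfun (\<lambda>x. x powr (-1/2)) X * Y * mfun (\<lambda>x. x powr (-1/2)) X) *
      mfun sqrt X"

definition op_log_convex :: "(real \<Rightarrow> real) \<Rightarrow> bool" where
  "op_log_convex f \<longleftrightarrow> (\<forall>d X Y. X \<in> carrier_mat d d \<longrightarrow> Y \<in> carrier_mat d d \<longrightarrow>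
      pd X \<longrightarrow> pd Y \<longrightarrow> loewner_le (mfun f (amean X Y)) (gmean (mfun f X) (mfun f Y)))"

text \<open>A map \<Phi> : M_n^k \<rightarrow> M_m, with k-tuples represented as functions nat \<Rightarrow> complex mat
  whose entries at indices \<ge> k are irrelevant.\<close>
definition multilinear_map :: "nat \<Rightarrow> nat \<Rightarrow> nat \<Rightarrow> ((nat \<Rightarrow> complex mat) \<Rightarrow> complex mat) \<Rightarrow> bool" where
  "multilinear_map n m k \<Phi> \<longleftrightarrow>
     (\<forall>A B. (\<forall>i<k. A i = B i) \<longrightarrow> \<Phi> A = \<Phi> B) \<and>
     (\<forall>A. (\<forall>i<k. A i \<in> carrier_mat n n) \<longrightarrow> \<Phi> A \<in> carrier_mat m m) \<and>
     (\<forall>A i X Y. (\<forall>j<k. A j \<in> carrier_mat n n) \<longrightarrow> i < k \<longrightarrow>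
        X \<in> carrier_mat n n \<longrightarrow> Y \<in> carrier_mat n n \<longrightarrow>
        \<Phi> (A(i := X + Y)) = \<Phi> (A(i := X)) + \<Phi> (A(i := Y))) \<and>
     (\<forall>A i X (c::complex). (\<forall>j<k. A j \<in> carrier_mat n n) \<longrightarrow> i < k \<longrightarrow>
        X \<in> carrier_mat n n \<longrightarrow> \<Phi> (A(i := c \<cdot>\<^sub>m X)) = c \<cdot>\<^sub>m \<Phi> (A(i := X)))"

definition positive_map :: "nat \<Rightarrow> nat \<Rightarrow> ((nat \<Rightarrow> complex mat) \<Rightarrow> complex mat) \<Rightarrow> bool" where
  "positive_map n k \<Phi> \<longleftrightarrow>
     (\<forall>A. (\<forall>i<k. A i \<in> carrier_mat n n \<and> psd (A i)) \<longrightarrow> psd (\<Phi> A))"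

end

theory Submission
  imports Defs "Jordan_Normal_Form.Spectral_Radius"
begin

text \<open>
  The geometric mean is the largest hermitian \<open>Z\<close> for which the block matrix \<open>[[X, Z], [Z, Y]]\<close> is
  positive.  A congruence diagonalises two positive definite matrices simultaneously, \<open>X = T T*\<close>,
  \<open>Y = T D\<^sup>2 T*\<close> and \<open>X # Y = T D T*\<close>, so the triple \<open>(X, X # Y, Y)\<close> is a finite sum of triples
  \<open>(S, a S, a\<^sup>2 S)\<close> with \<open>S\<close> positive semidefinite and \<open>a \<ge> 0\<close>.  Applying a positive multilinear map
  entrywise to triples of this kind expands, by multilinearity, into a sum of triples of the
  same kind, hence gives a positive block.  Together with monotonicity of \<open>\<Phi>\<close> and maximality of the
  mean this is (i); (ii) follows as inversion is antitone and \<open>(X # Y)\<inverse> = X\<inverse> # Y\<inverse>\<close>.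
  For (iii), the positive block tested on \<open>(v, -v)\<close> gives midpoint convexity of \<open>F\<close>, which Peierls'
  inequality carries over to \<open>Tr h(F)\<close>; along a segment this function is bounded above, so midpoint
  convexity upgrades to convexity.
\<close>

section \<open>Adjoints and the spectral theorem\<close>

unbundle no vec_syntax

text \<open>A positive map need not preserve positivity of general 2 by 2 blocks. It does so here
  because the entries of an elementary triple are multiples of one positive matrix: if argument i is
  (S_i, a_i S_i, a_i^2 S_i), multilinearity yields \<Phi>(S_1, ..., S_k) times (1, p, p^2), with p
  the product of the a_i. Two degeneracies shape the proof. The mean is built from a negative power,
  so it is meaningful for positive definite matrices, while the \<open>f i\<close> may vanish. A
  zero of a nonnegative operator log-convex function spreads to all of (0, infinity), so each
  argument supplies either a genuine mean or the zero triple. Moreover F may be singular even when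
  all \<open>f i\<close> are positive. Hence the middle entry is kept as a matrix \<open>Z\<close>
  in a positive block, and means of values of F appear only in (i) and (ii), where these values are
  positive definite. Log-convexity is assumed at midpoints, so (iii) must still reach all weights.
  The upper bound used for this only asks that the spectra along a segment stay in a compact part of
  (0, infinity); continuity of the functional calculus is avoided.\<close>

abbreviation adj :: "complex mat \<Rightarrow> complex mat" where "adj \<equiv> mat_adjoint"

abbreviation rdiag :: "nat \<Rightarrow> (nat \<Rightarrow> real) \<Rightarrow> complex mat" where
  "rdiag n d \<equiv> mat_diag n (\<lambda>i. complex_of_real (d i))"

lemma adjoint_dim [simp]: "dim_row (adj A) = dim_col A" "dim_col (adj A) = dim_row A"
  unfolding mat_adjoint_def by auto

lemma adjoint_carrier [simp]: "A \<in> carrier_mat n m \<Longrightarrow> adj A \<in> carrier_mat m n"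
  by (auto intro!: carrier_matI)

lemma adjoint_index [simp]:
  "i < dim_col A \<Longrightarrow> j < dim_row A \<Longrightarrow> adj A $$ (i,j) = cnj (A $$ (j,i))"
  unfolding mat_adjoint_def by (simp add: mat_of_rows_index)

lemma adjoint_mult_vec_carrier [simp]:
  "A \<in> carrier_mat n m \<Longrightarrow> v \<in> carrier_vec n \<Longrightarrow> adj A *\<^sub>v v \<in> carrier_vec m"
  by (rule mult_mat_vec_carrier[OF adjoint_carrier])

lemma col_carrier [simp]: "A \<in> carrier_mat n m \<Longrightarrow> col A j \<in> carrier_vec n"
  by (metis carrier_matD(1) col_dim)

lemma mult_carrier_square [simp]:
  "A \<in> carrier_mat n n \<Longrightarrow> B \<in> carrier_mat n n \<Longrightarrow> A * B \<in> carrier_mat n n"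
  by (rule mult_carrier_mat)

lemma adjoint_adjoint [simp]: "adj (adj A) = A"
  by (rule eq_matI) auto

lemma adjoint_mult:
  assumes "A \<in> carrier_mat n m" "B \<in> carrier_mat m l"
  shows "adj (A * B) = adj B * adj A"
  using assms by (intro eq_matI) (auto simp: scalar_prod_def mult.commute)

lemma adjoint_one [simp]: "adj (1\<^sub>m n) = 1\<^sub>m n"
  by (rule eq_matI) auto

lemma adjoint_rdiag [simp]: "adj (rdiag n d) = rdiag n d"
  by (rule eq_matI) (auto simp: mat_diag_def)

section \<open>The complex inner product, linear in its first argument\<close>

lemma cscalar_eq_sum:
  assumes "v \<in> carrier_vec n" "w \<in> carrier_vec n"
  shows "(v :: complex Matrix.vec) \<bullet>c w = (\<Sum>i<n. v $ i * cnj (w $ i))"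
  using assms by (simp add: scalar_prod_def lessThan_atLeast0)

lemma cscalar_adjoint:
  assumes A: "A \<in> carrier_mat n m" and v: "v \<in> carrier_vec m" and w: "w \<in> carrier_vec n"
  shows "(A *\<^sub>v v) \<bullet>c w = v \<bullet>c (adj A *\<^sub>v w)"
proof -
  have "(A *\<^sub>v v) \<bullet>c w = (\<Sum>i<n. \<Sum>j<m. A $$ (i,j) * v $ j * cnj (w $ i))"
    using A v w by (subst cscalar_eq_sum[of _ n])
      (auto simp: scalar_prod_def lessThan_atLeast0 sum_distrib_right intro!: sum.cong)
  also have "\<dots> = (\<Sum>j<m. \<Sum>i<n. A $$ (i,j) * v $ j * cnj (w $ i))"
    by (rule sum.swap)
  also have "\<dots> = v \<bullet>c (adj A *\<^sub>v w)"
    using A v w by (subst cscalar_eq_sum[of _ m])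
      (auto simp: scalar_prod_def lessThan_atLeast0 sum_distrib_left mult_ac intro!: sum.cong)
  finally show ?thesis .
qed

lemma cscalar_commute:
  assumes "v \<in> carrier_vec n" "w \<in> carrier_vec n"
  shows "(v :: complex Matrix.vec) \<bullet>c w = cnj (w \<bullet>c v)"
  using assms by (simp add: cscalar_eq_sum mult.commute)

lemma cscalar_add_left:
  assumes "u \<in> carrier_vec n" "v \<in> carrier_vec n" "w \<in> carrier_vec n"
  shows "((u :: complex Matrix.vec) + v) \<bullet>c w = u \<bullet>c w + v \<bullet>c w"
  using assms by (simp add: cscalar_eq_sum[of _ n] sum.distrib algebra_simps)

lemma cscalar_minus_left:
  assumes "u \<in> carrier_vec n" "v \<in> carrier_vec n" "w \<in> carrier_vec n"
  shows "((u :: complex Matrix.vec) - v) \<bullet>c w = u \<bullet>c w - v \<bullet>c w"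
  using assms by (simp add: cscalar_eq_sum[of _ n] sum_subtractf algebra_simps)

lemma cscalar_add_right:
  assumes "u \<in> carrier_vec n" "v \<in> carrier_vec n" "w \<in> carrier_vec n"
  shows "(u :: complex Matrix.vec) \<bullet>c (v + w) = u \<bullet>c v + u \<bullet>c w"
  using assms by (simp add: cscalar_eq_sum[of _ n] sum.distrib algebra_simps)

lemma cscalar_minus_right:
  assumes "u \<in> carrier_vec n" "v \<in> carrier_vec n" "w \<in> carrier_vec n"
  shows "(u :: complex Matrix.vec) \<bullet>c (v - w) = u \<bullet>c v - u \<bullet>c w"
  using assms by (simp add: cscalar_eq_sum[of _ n] sum_subtractf algebra_simps)

lemma cscalar_smult_left:
  assumes "v \<in> carrier_vec n" "w \<in> carrier_vec n"
  shows "(c \<cdot>\<^sub>v (v :: complex Matrix.vec)) \<bullet>c w = c * (v \<bullet>c w)"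
  using assms by (simp add: cscalar_eq_sum[of _ n] sum_distrib_left algebra_simps)

lemma cscalar_smult_right:
  assumes "v \<in> carrier_vec n" "w \<in> carrier_vec n"
  shows "(v :: complex Matrix.vec) \<bullet>c (c \<cdot>\<^sub>v w) = cnj c * (v \<bullet>c w)"
  using assms by (simp add: cscalar_eq_sum[of _ n] sum_distrib_left algebra_simps)

lemma cscalar_self:
  assumes "v \<in> carrier_vec n"
  shows "(v :: complex Matrix.vec) \<bullet>c v = complex_of_real (\<Sum>i<n. (cmod (v $ i))\<^sup>2)"
  using assms by (simp add: cscalar_eq_sum[of _ n] complex_norm_square[symmetric])

lemma cscalar_self_nonneg: "v \<in> carrier_vec n \<Longrightarrow> 0 \<le> Re ((v :: complex Matrix.vec) \<bullet>c v)"
  by (simp add: cscalar_self sum_nonneg)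

lemma cscalar_self_pos:
  assumes v: "(v :: complex Matrix.vec) \<in> carrier_vec n" and "v \<noteq> 0\<^sub>v n"
  shows "0 < Re (v \<bullet>c v)"
proof -
  obtain i where i: "i < n" "v $ i \<noteq> 0"
    using assms by (metis eq_vecI carrier_vecD index_zero_vec)
  hence "0 < (\<Sum>i<n. (cmod (v $ i))\<^sup>2)"
    by (intro sum_pos2[of _ i]) auto
  thus ?thesis using v by (simp add: cscalar_self)
qed

section \<open>Unitary and hermitian matrices, and diagonalisation\<close>

lemma unitary_right_inverse:
  assumes "unitary U" "U \<in> carrier_mat n n"
  shows "adj U * U = 1\<^sub>m n" "U * adj U = 1\<^sub>m n"
proof -
  show 1: "adj U * U = 1\<^sub>m n" using assms unfolding unitary_def by auto
  show "U * adj U = 1\<^sub>m n"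
    by (rule mat_mult_left_right_inverse[OF _ _ 1]) (use assms in auto)
qed

lemma unitaryI:
  assumes "U \<in> carrier_mat n n" "adj U * U = 1\<^sub>m n"
  shows "unitary U"
  using assms unfolding unitary_def by auto

lemma unitary_adjoint: "unitary U \<Longrightarrow> U \<in> carrier_mat n n \<Longrightarrow> unitary (adj U)"
  by (intro unitaryI[of _ n]) (auto simp: unitary_right_inverse)

lemma unitary_mult:
  assumes "unitary U" "U \<in> carrier_mat n n" "unitary V" "V \<in> carrier_mat n n"
  shows "unitary (U * V)"
proof (rule unitaryI[of _ n])
  have "adj (U * V) * (U * V) = adj V * (adj U * U) * V"
    using assms by (simp add: adjoint_mult[of _ n n _ n] assoc_mult_mat[of _ n n _ n _ n])
  thus "adj (U * V) * (U * V) = 1\<^sub>m n"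
    using assms by (simp add: unitary_right_inverse)
qed (use assms in auto)

lemma hermitian_adjoint: "hermitian A \<Longrightarrow> adj A = A"
  unfolding hermitian_def by simp

lemma hermitianI: "A \<in> carrier_mat n n \<Longrightarrow> adj A = A \<Longrightarrow> hermitian A"
  unfolding hermitian_def by auto

lemma hermitian_conj:
  assumes "A \<in> carrier_mat n n" "hermitian A" "T \<in> carrier_mat n n"
  shows "hermitian (T * A * adj T)"
  using assms by (intro hermitianI[of _ n])
    (auto simp: adjoint_mult[of _ n n _ n] hermitian_adjoint assoc_mult_mat[of _ n n _ n _ n])

lemma hermitian_rdiag [simp]: "hermitian (rdiag n d)"
  by (rule hermitianI[of _ n]) auto

text \<open>Gram-Schmidt keeps the head of its list and returns orthogonal but not normalised
  vectors; normalising them turns the first column into a multiple of \<open>v\<close>. With an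
  eigenvector for \<open>v\<close> this starts the deflation in
  \<open>spectral_theorem\<close>.\<close>

lemma unitary_completion:
  assumes v: "(v :: complex Matrix.vec) \<in> carrier_vec n" and v0: "v \<noteq> 0\<^sub>v n" and n: "0 < n"
  obtains W c where "W \<in> carrier_mat n n" "unitary W" "col W 0 = c \<cdot>\<^sub>v v"
proof -
  interpret cof_vec_space n "TYPE(complex)" .
  define b where "b = basis_completion v"
  define ws where "ws = gram_schmidt n b"
  note b = basis_completion[OF v v0, folded b_def]
  note ws = gram_schmidt_result[OF b(2,4,5) ws_def]
  have len: "length ws = n" using ws b by simp
  obtain bs where "b = v # bs" using b(6,7) n by (cases b) auto
  hence "hd ws = v" unfolding ws_def using gram_schmidt_hd[OF v] by simp
  hence ws0: "ws ! 0 = v" using len n by (cases ws) auto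
  have wsc: "\<And>i. i < n \<Longrightarrow> ws ! i \<in> carrier_vec n" using ws(3) len by (auto simp: subset_iff)
  define r where "r i = sqrt (Re (ws ! i \<bullet>c ws ! i))" for i
  have orth: "i < n \<Longrightarrow> j < n \<Longrightarrow> (ws ! i \<bullet>c ws ! j = 0) = (i \<noteq> j)" for i j
    using corthogonalD[OF ws(2)] len by auto
  have rr: "complex_of_real (r i) * complex_of_real (r i) = ws ! i \<bullet>c ws ! i" "r i \<noteq> 0"
    if i: "i < n" for i
  proof -
    have "ws ! i \<bullet>c ws ! i = complex_of_real (Re (ws ! i \<bullet>c ws ! i))"
      using cscalar_self[OF wsc[OF i]] by (metis Re_complex_of_real)
    moreover have "0 \<le> Re (ws ! i \<bullet>c ws ! i)" using cscalar_self_nonneg[OF wsc[OF i]] .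
    ultimately show "complex_of_real (r i) * complex_of_real (r i) = ws ! i \<bullet>c ws ! i"
      unfolding r_def by (metis of_real_mult real_sqrt_mult_self abs_of_nonneg)
    thus "r i \<noteq> 0" using orth[OF i i] by auto
  qed
  define W where "W = mat_of_cols n (map (\<lambda>i. complex_of_real (1 / r i) \<cdot>\<^sub>v ws ! i) [0..<n])"
  have W: "W \<in> carrier_mat n n" unfolding W_def by auto
  have colW: "col W i = complex_of_real (1 / r i) \<cdot>\<^sub>v ws ! i" if "i < n" for i
    unfolding W_def using that wsc by (subst col_mat_of_cols) auto
  have "adj W * W = 1\<^sub>m n"
  proof (rule eq_matI)
    fix i j assume "i < dim_row (1\<^sub>m n :: complex mat)" "j < dim_col (1\<^sub>m n :: complex mat)"
    hence ij: "i < n" "j < n" by auto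
    have "(adj W * W) $$ (i,j) = col W j \<bullet>c col W i"
      using ij W by (auto simp: scalar_prod_def mult.commute intro!: sum.cong)
    also have "\<dots> = complex_of_real (1 / r j) * (complex_of_real (1 / r i) * (ws ! j \<bullet>c ws ! i))"
      unfolding colW[OF ij(1)] colW[OF ij(2)] using wsc ij
      by (simp add: cscalar_smult_left[of _ n] cscalar_smult_right[of _ n])
    also have "\<dots> = 1\<^sub>m n $$ (i,j)"
    proof (cases "i = j")
      case True
      then show ?thesis using rr[OF ij(1)] ij by (simp flip: rr(1))
    next
      case False
      then show ?thesis using orth[OF ij(2,1)] ij by simp
    qed
    finally show "(adj W * W) $$ (i,j) = 1\<^sub>m n $$ (i,j)" .
  qed (use W in auto)
  hence "unitary W" using W by (intro unitaryI)
  thus ?thesis using that[OF W] colW[OF n] ws0 by simp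
qed

lemma adjoint_four_block:
  assumes "A \<in> carrier_mat n1 m1" "B \<in> carrier_mat n1 m2" "C \<in> carrier_mat n2 m1" "D \<in> carrier_mat n2 m2"
  shows "adj (four_block_mat A B C D) = four_block_mat (adj A) (adj C) (adj B) (adj D)"
  using assms by (intro eq_matI) auto

lemma mult_block_diag:
  assumes "(A :: complex mat) \<in> carrier_mat k k" "D \<in> carrier_mat n n" "A' \<in> carrier_mat k k" "D' \<in> carrier_mat n n"
  shows "four_block_mat A (0\<^sub>m k n) (0\<^sub>m n k) D * four_block_mat A' (0\<^sub>m k n) (0\<^sub>m n k) D'
    = four_block_mat (A * A') (0\<^sub>m k n) (0\<^sub>m n k) (D * D')"
  using assms by (subst mult_four_block_mat[of _ k k _ n _ n _ _ k _ n])
    (auto simp: left_add_zero_mat[of _ k k] right_add_zero_mat[of _ k k])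

lemma unitary_conj_cancel:
  assumes A: "A \<in> carrier_mat n n" and W: "W \<in> carrier_mat n n" "unitary W"
  shows "W * (adj W * A * W) * adj W = A"
proof -
  have "W * (adj W * A * W) * adj W = (W * adj W) * A * (W * adj W)"
    using A W by (simp add: assoc_mult_mat[of _ n n _ n _ n])
  thus ?thesis using A W by (simp add: unitary_right_inverse)
qed

text \<open>Deflation: in an orthonormal basis that begins with an eigenvector, the first column
  vanishes below the diagonal, by hermiticity the first row vanishes beyond it, and the induction
  hypothesis applies to the remaining hermitian block.\<close>

theorem spectral_theorem:
  assumes "A \<in> carrier_mat n n" "hermitian A"
  shows "\<exists>U d. U \<in> carrier_mat n n \<and> unitary U \<and> A = U * rdiag n d * adj U"
  using assms
proof (induction n arbitrary: A)
  case 0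
  have "A = 1\<^sub>m 0 * rdiag 0 (\<lambda>_. 0) * adj (1\<^sub>m 0)" using 0 by (intro eq_matI) auto
  moreover have "unitary (1\<^sub>m 0)" by (rule unitaryI[of _ 0]) auto
  ultimately show ?case by (intro exI[of _ "1\<^sub>m 0"] exI[of _ "\<lambda>_. 0"]) auto
next
  case (Suc n A)
  note A = Suc.prems(1)
  obtain e where "eigenvalue A e" using spectrum_non_empty[OF A] unfolding spectrum_def by auto
  then obtain v where "eigenvector A v e" unfolding eigenvalue_def by auto
  hence v: "v \<in> carrier_vec (Suc n)" "v \<noteq> 0\<^sub>v (Suc n)" "A *\<^sub>v v = e \<cdot>\<^sub>v v"
    using A unfolding eigenvector_def by auto
  obtain W c where W: "W \<in> carrier_mat (Suc n) (Suc n)" "unitary W" "col W 0 = c \<cdot>\<^sub>v v"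
    using unitary_completion[OF v(1,2)] by auto
  define B where "B = adj W * A * W"
  have B: "B \<in> carrier_mat (Suc n) (Suc n)" unfolding B_def using A W by auto
  have hB: "adj B = B"
    using hermitian_conj[OF A Suc.prems(2), of "adj W"] W unfolding B_def hermitian_def by auto
  have "A *\<^sub>v (c \<cdot>\<^sub>v v) = e \<cdot>\<^sub>v (c \<cdot>\<^sub>v v)" using mult_mat_vec[OF A v(1)] v
    by (simp add: smult_smult_assoc mult.commute)
  moreover have "col B 0 = adj W *\<^sub>v (A *\<^sub>v col W 0)"
    unfolding B_def using A W(1)
    by (simp add: assoc_mult_mat[of _ "Suc n" "Suc n" _ "Suc n" _ "Suc n"] col_mult2[of _ "Suc n" "Suc n" _ "Suc n"]
        mult_mat_vec_def)
  ultimately have "col B 0 = adj W *\<^sub>v (e \<cdot>\<^sub>v col W 0)"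
    using W(3) by simp
  also have "\<dots> = e \<cdot>\<^sub>v (adj W *\<^sub>v col W 0)"
    using W(1) by (intro mult_mat_vec[of _ "Suc n" "Suc n"]) auto
  also have "adj W *\<^sub>v col W 0 = col (adj W * W) 0" using W(1) by (simp add: col_mult2[of _ "Suc n" "Suc n" _ "Suc n"])
  also have "\<dots> = unit_vec (Suc n) 0" using W by (simp add: unitary_right_inverse)
  finally have col0: "col B 0 = e \<cdot>\<^sub>v unit_vec (Suc n) 0" .
  have B0: "B $$ (i,0) = (if i = 0 then e else 0)" if "i < Suc n" for i
    using arg_cong[OF col0, of "\<lambda>v. v $ i"] that B by simp
  have B0': "B $$ (0,j) = (if j = 0 then cnj e else 0)" if "j < Suc n" for j
  proof -
    have "B $$ (0,j) = adj B $$ (0,j)" using hB by simp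
    thus ?thesis using B that B0[OF that] by simp
  qed
  \<comment> \<open>The corner entry is read off once from the column and once from the row, so the
    eigenvalue is real and \<open>d'\<close> can store \<open>Re e\<close>.\<close>
  have e: "cnj e = e" using B0[of 0] B0'[of 0] by simp
  define C where "C = Matrix.mat n n (\<lambda>(i,j). B $$ (Suc i, Suc j))"
  have C: "C \<in> carrier_mat n n" unfolding C_def by auto
  have "hermitian C"
  proof (rule hermitianI[OF C])
    show "adj C = C"
    proof (rule eq_matI)
      fix i j assume "i < dim_row C" "j < dim_col C"
      thus "adj C $$ (i,j) = C $$ (i,j)"
        using arg_cong[OF hB, of "\<lambda>M. M $$ (Suc i, Suc j)"] B C by (simp add: C_def)
    qed (use C in auto)
  qed
  from Suc.IH[OF C this] obtain V d where V: "V \<in> carrier_mat n n" "unitary V" "C = V * rdiag n d * adj V"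
    by blast
  define V' where "V' = four_block_mat (1\<^sub>m 1) (0\<^sub>m 1 n) (0\<^sub>m n 1) V"
  define d' where "d' i = (case i of 0 \<Rightarrow> Re e | Suc i \<Rightarrow> d i)" for i
  have V': "V' \<in> carrier_mat (Suc n) (Suc n)" unfolding V'_def using V by (auto intro!: carrier_matI)
  have aV': "adj V' = four_block_mat (1\<^sub>m 1) (0\<^sub>m 1 n) (0\<^sub>m n 1) (adj V)"
    unfolding V'_def using V by (subst adjoint_four_block) auto
  have "adj V' * V' = 1\<^sub>m (Suc n)"
    unfolding aV' unfolding V'_def using V
    by (subst mult_four_block_mat[of _ 1 1 _ n _ n _ _ 1 _ n]) (auto simp: unitary_right_inverse)
  hence uV': "unitary V'" using V' by (intro unitaryI)
  have D: "rdiag (Suc n) d' = four_block_mat (mat_diag 1 (\<lambda>_. e)) (0\<^sub>m 1 n) (0\<^sub>m n 1) (rdiag n d)"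
    using e by (intro eq_matI) (auto simp: mat_diag_def d'_def complex_eq_iff split: nat.splits)
  have Be: "B = four_block_mat (mat_diag 1 (\<lambda>_. e)) (0\<^sub>m 1 n) (0\<^sub>m n 1) C"
    using B B0 B0' e C by (intro eq_matI) (auto simp: mat_diag_def C_def)
  have E: "mat_diag 1 (\<lambda>_. e) \<in> carrier_mat 1 1" by simp
  have "V' * rdiag (Suc n) d' * adj V' = B"
    unfolding D aV' Be V(3) unfolding V'_def using V E
    by (simp add: mult_block_diag[where k=1 and n=n] left_mult_one_mat[OF E] right_mult_one_mat[OF E]
        del: One_nat_def)
  hence "A = W * (V' * rdiag (Suc n) d' * adj V') * adj W"
    using unitary_conj_cancel[OF A W(1,2)] unfolding B_def by simp
  also have "\<dots> = (W * V') * rdiag (Suc n) d' * adj (W * V')"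
    using W V' by (simp add: adjoint_mult[of _ "Suc n" "Suc n" _ "Suc n"]
        assoc_mult_mat[of _ "Suc n" "Suc n" _ "Suc n" _ "Suc n"])
  finally show ?case using W V' uV' unitary_mult[OF W(2,1) uV' V']
    by (intro exI[of _ "W * V'"] exI[of _ d']) auto
qed

section \<open>Functional calculus and the Loewner order\<close>

lemma mult_one_square [simp]:
  "A \<in> carrier_mat n n \<Longrightarrow> 1\<^sub>m n * A = (A :: complex mat)" "A \<in> carrier_mat n n \<Longrightarrow> A * 1\<^sub>m n = A"
  by auto

lemma mult_mat_vec_carrier_square [simp]:
  "A \<in> carrier_mat n n \<Longrightarrow> v \<in> carrier_vec n \<Longrightarrow> A *\<^sub>v v \<in> carrier_vec n"
  by (rule mult_mat_vec_carrier)

lemma rdiag_mult: "rdiag n a * rdiag n b = rdiag n (\<lambda>i. a i * b i)"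
  by simp

lemma rdiag_mult_vec:
  "v \<in> carrier_vec n \<Longrightarrow> i < n \<Longrightarrow> (rdiag n d *\<^sub>v v) $ i = complex_of_real (d i) * v $ i"
  by (simp add: mat_diag_def scalar_prod_def if_distrib[of "\<lambda>x. x * _"] cong: if_cong)

lemma unitary_conj_rdiag_mult:
  assumes "U \<in> carrier_mat n n" "unitary U"
  shows "(U * rdiag n a * adj U) * (U * rdiag n b * adj U) = U * rdiag n (\<lambda>i. a i * b i) * adj U"
proof -
  have "(U * rdiag n a * adj U) * (U * rdiag n b * adj U)
    = U * rdiag n a * (adj U * U) * rdiag n b * adj U"
    using assms(1) by (simp add: assoc_mult_mat[of _ n n _ n _ n] del: mat_diag_diag)
  also have "\<dots> = U * (rdiag n a * rdiag n b) * adj U"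
    using assms by (simp add: unitary_right_inverse assoc_mult_mat[of _ n n _ n _ n] del: mat_diag_diag)
  finally show ?thesis by simp
qed

text \<open>Two unitary diagonalisations are linked by a unitary \<open>Q\<close> with \<open>e i * Q i j = Q i j * d j\<close>,
  and this relation is inherited by \<open>f \<circ> e\<close> and \<open>f \<circ> d\<close>.\<close>
lemma mfun_diagonalised:
  assumes U: "U \<in> carrier_mat n n" "unitary U" and A: "A = U * rdiag n d * adj U"
  shows "mfun f A = U * rdiag n (\<lambda>i. f (d i)) * adj U"
proof -
  have dim: "dim_row A = n" unfolding A using U by simp
  let ?P = "\<lambda>B. \<exists>U d. unitary U \<and> U \<in> carrier_mat (dim_row A) (dim_row A) \<and>
      A = U * rdiag (dim_row A) d * adj U \<and> B = U * rdiag (dim_row A) (\<lambda>i. f (d i)) * adj U"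
  have "?P (mfun f A)" unfolding mfun_def
    by (rule someI[of ?P "U * rdiag n (\<lambda>i. f (d i)) * adj U"]) (use dim U A in blast)
  then obtain V e where V: "unitary V" "V \<in> carrier_mat n n" "A = V * rdiag n e * adj V"
    "mfun f A = V * rdiag n (\<lambda>i. f (e i)) * adj V" unfolding dim by blast
  define Q where "Q = adj V * U"
  have Q: "Q \<in> carrier_mat n n" unfolding Q_def using U V by simp
  have "rdiag n e * Q = (adj V * V) * rdiag n e * adj V * U"
    unfolding Q_def using U V(1,2) by (simp add: unitary_right_inverse assoc_mult_mat[of _ n n _ n _ n])
  also have "\<dots> = adj V * A * U" unfolding V(3)
    using U V(2) by (simp add: assoc_mult_mat[of _ n n _ n _ n])
  also have "\<dots> = adj V * U * rdiag n d * (adj U * U)"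
    unfolding A using U V(2) by (simp add: assoc_mult_mat[of _ n n _ n _ n] del: V)
  also have "\<dots> = Q * rdiag n d"
    unfolding Q_def using U V(2) by (simp add: unitary_right_inverse)
  finally have *: "rdiag n e * Q = Q * rdiag n d" .
  have entry: "complex_of_real (e i) * Q $$ (i,j) = Q $$ (i,j) * complex_of_real (d j)" if "i < n" "j < n" for i j
    using arg_cong[OF *, of "\<lambda>M. M $$ (i,j)"] that Q
    by (simp add: mat_diag_mult_left[of _ n n] mat_diag_mult_right[of _ n n])
  have "rdiag n (\<lambda>i. f (e i)) * Q = Q * rdiag n (\<lambda>i. f (d i))"
  proof (rule eq_matI)
    fix i j assume "i < dim_row (Q * rdiag n (\<lambda>i. f (d i)))" "j < dim_col (Q * rdiag n (\<lambda>i. f (d i)))"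
    hence "i < n" "j < n" using Q by (auto simp: mat_diag_def)
    with entry[OF this] show "(rdiag n (\<lambda>i. f (e i)) * Q) $$ (i,j) = (Q * rdiag n (\<lambda>i. f (d i))) $$ (i,j)"
      using Q by (cases "Q $$ (i,j) = 0") (auto simp: mat_diag_mult_left[of _ n n] mat_diag_mult_right[of _ n n])
  qed (use Q in \<open>auto simp: mat_diag_def\<close>)
  hence "V * (rdiag n (\<lambda>i. f (e i)) * Q) * adj U = V * (Q * rdiag n (\<lambda>i. f (d i))) * adj U" by simp
  moreover have "V * (rdiag n (\<lambda>i. f (e i)) * Q) * adj U = V * rdiag n (\<lambda>i. f (e i)) * adj V * (U * adj U)"
    unfolding Q_def using U(1) V(2) by (simp add: assoc_mult_mat[of _ n n _ n _ n])
  moreover have "V * (Q * rdiag n (\<lambda>i. f (d i))) * adj U = (V * adj V) * U * rdiag n (\<lambda>i. f (d i)) * adj U"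
    unfolding Q_def using U(1) V(2) by (simp add: assoc_mult_mat[of _ n n _ n _ n])
  ultimately show ?thesis
    unfolding V(4) using U V(1,2) by (simp add: unitary_right_inverse)
qed

text \<open>Moving \<open>T\<close> to the other side of the inner product leaves a weighted sum of
  squares. As \<open>T\<close> is arbitrary, this serves congruences as well as
  diagonalisations.\<close>

lemma quadratic_form_conj_rdiag:
  assumes T: "T \<in> carrier_mat n n" and v: "v \<in> carrier_vec n"
  shows "Re (((T * rdiag n d * adj T) *\<^sub>v v) \<bullet>c v) = (\<Sum>i<n. d i * (cmod ((adj T *\<^sub>v v) $ i))\<^sup>2)"
proof -
  let ?w = "adj T *\<^sub>v v"
  have w: "?w \<in> carrier_vec n" using T v by simp
  have "((T * rdiag n d * adj T) *\<^sub>v v) \<bullet>c v = (T *\<^sub>v (rdiag n d *\<^sub>v ?w)) \<bullet>c v"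
    using T v by (simp add: assoc_mult_mat_vec[of _ n n _ n])
  also have "\<dots> = (rdiag n d *\<^sub>v ?w) \<bullet>c ?w"
    using T v w by (intro cscalar_adjoint[of _ n n]) (auto intro: mult_mat_vec_carrier[of _ n n])
  also have "\<dots> = (\<Sum>i<n. (rdiag n d *\<^sub>v ?w) $ i * cnj (?w $ i))"
    using w by (intro cscalar_eq_sum) (auto intro: mult_mat_vec_carrier[of _ n n])
  also have "\<dots> = (\<Sum>i<n. complex_of_real (d i * (cmod (?w $ i))\<^sup>2))"
    using w by (intro sum.cong) (auto simp: rdiag_mult_vec mult.assoc complex_norm_square[symmetric] simp del: index_mult_mat_vec)
  also have "\<dots> = complex_of_real (\<Sum>i<n. d i * (cmod (?w $ i))\<^sup>2)" by simp
  finally show ?thesis by (simp del: index_mult_mat_vec)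
qed

lemma unitary_adjoint_col:
  assumes "U \<in> carrier_mat n n" "unitary U" "j < n"
  shows "adj U *\<^sub>v col U j = unit_vec n j"
  using assms by (simp flip: col_mult2[of _ n n _ n] add: unitary_right_inverse)

lemma unitary_col_nonzero:
  assumes "U \<in> carrier_mat n n" "unitary U" "j < n"
  shows "col U j \<noteq> 0\<^sub>v n"
proof
  assume "col U j = 0\<^sub>v n"
  hence "adj U *\<^sub>v col U j = 0\<^sub>v n" using assms(1) by auto
  thus False using unitary_adjoint_col[OF assms] assms(3) by simp
qed

text \<open>\<open>adj U\<close> sends column \<open>j\<close> to the unit vector, which isolates
  one eigenvalue; this is how the sign of a form passes to the diagonal entries.\<close>

lemma quadratic_form_diagonalised_col:
  assumes U: "U \<in> carrier_mat n n" "unitary U" and j: "j < n"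
  shows "Re (((U * rdiag n d * adj U) *\<^sub>v col U j) \<bullet>c col U j) = d j"
proof -
  have "Re (((U * rdiag n d * adj U) *\<^sub>v col U j) \<bullet>c col U j) = (\<Sum>i<n. d i * (cmod (unit_vec n j $ i))\<^sup>2)"
    using U j by (subst quadratic_form_conj_rdiag) (auto simp: unitary_adjoint_col simp del: index_mult_mat_vec)
  also have "\<dots> = (\<Sum>i<n. if i = j then d i else 0)"
    using j by (intro sum.cong) auto
  finally show ?thesis using j by simp
qed

lemma psdD: "psd A \<Longrightarrow> A \<in> carrier_mat n n \<Longrightarrow> v \<in> carrier_vec n \<Longrightarrow> 0 \<le> Re ((A *\<^sub>v v) \<bullet>c v)"
  unfolding psd_def by auto

lemma pdD: "pd A \<Longrightarrow> A \<in> carrier_mat n n \<Longrightarrow> v \<in> carrier_vec n \<Longrightarrow> v \<noteq> 0\<^sub>v n \<Longrightarrow> 0 < Re ((A *\<^sub>v v) \<bullet>c v)"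
  unfolding pd_def by auto

lemma psdI:
  "A \<in> carrier_mat n n \<Longrightarrow> hermitian A \<Longrightarrow> (\<And>v. v \<in> carrier_vec n \<Longrightarrow> 0 \<le> Re ((A *\<^sub>v v) \<bullet>c v)) \<Longrightarrow> psd A"
  unfolding psd_def by auto

lemma pdI:
  "A \<in> carrier_mat n n \<Longrightarrow> hermitian A \<Longrightarrow>
   (\<And>v. v \<in> carrier_vec n \<Longrightarrow> v \<noteq> 0\<^sub>v n \<Longrightarrow> 0 < Re ((A *\<^sub>v v) \<bullet>c v)) \<Longrightarrow> pd A"
  unfolding pd_def by auto

lemma psd_hermitian: "psd A \<Longrightarrow> hermitian A"
  unfolding psd_def by auto

lemma pd_hermitian: "pd A \<Longrightarrow> hermitian A"
  unfolding pd_def by auto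

lemma pd_imp_psd:
  assumes "pd A"
  shows "psd A"
proof -
  have A: "A \<in> carrier_mat (dim_row A) (dim_row A)"
    using assms unfolding pd_def hermitian_def by (intro carrier_matI) auto
  have "0 \<le> Re ((A *\<^sub>v v) \<bullet>c v)" if "v \<in> carrier_vec (dim_row A)" for v
  proof (cases "v = 0\<^sub>v (dim_row A)")
    case True
    then show ?thesis by (simp add: scalar_prod_def)
  next
    case False
    then show ?thesis using less_imp_le[OF pdD[OF assms A that]] by simp
  qed
  thus ?thesis using pd_hermitian[OF assms] unfolding psd_def by blast
qed

lemma psd_conj_rdiag:
  assumes "T \<in> carrier_mat n n" "\<And>i. i < n \<Longrightarrow> 0 \<le> d i"
  shows "psd (T * rdiag n d * adj T)"
  using assms by (intro psdI[of _ n] hermitian_conj[of _ n])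
    (auto simp: quadratic_form_conj_rdiag intro!: sum_nonneg simp del: index_mult_mat_vec)

lemma pd_diagonalised:
  assumes U: "U \<in> carrier_mat n n" "unitary U" and "\<And>i. i < n \<Longrightarrow> 0 < d i"
  shows "pd (U * rdiag n d * adj U)"
proof (intro pdI[of _ n] hermitian_conj[of _ n] hermitian_rdiag)
  fix v :: "complex Matrix.vec" assume v: "v \<in> carrier_vec n" "v \<noteq> 0\<^sub>v n"
  have "adj U *\<^sub>v v \<noteq> 0\<^sub>v n"
  proof
    assume "adj U *\<^sub>v v = 0\<^sub>v n"
    hence "U *\<^sub>v (adj U *\<^sub>v v) = 0\<^sub>v n" using U by auto
    moreover have "U *\<^sub>v (adj U *\<^sub>v v) = v"
      using U v by (simp flip: assoc_mult_mat_vec[of _ n n _ n] add: unitary_right_inverse)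
    ultimately show False using v by simp
  qed
  moreover have "adj U *\<^sub>v v \<in> carrier_vec n" using U v by simp
  ultimately obtain i where i: "i < n" "(adj U *\<^sub>v v) $ i \<noteq> 0"
    by (metis eq_vecI carrier_vecD index_zero_vec)
  show "0 < Re (((U * rdiag n d * adj U) *\<^sub>v v) \<bullet>c v)"
    unfolding quadratic_form_conj_rdiag[OF U(1) v(1)]
    by (rule sum_pos2[of _ i]) (use i assms(3) less_imp_le[OF assms(3)] in \<open>auto simp del: index_mult_mat_vec\<close>)
qed (use U in auto)

lemma psd_spectral:
  assumes A: "A \<in> carrier_mat n n" "psd A"
  obtains U d where "U \<in> carrier_mat n n" "unitary U" "A = U * rdiag n d * adj U" "\<And>i. i < n \<Longrightarrow> 0 \<le> d i"
proof -
  obtain U d where U: "U \<in> carrier_mat n n" "unitary U" "A = U * rdiag n d * adj U"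
    using spectral_theorem[OF A(1) psd_hermitian[OF A(2)]] by blast
  have "0 \<le> d i" if "i < n" for i
    using psdD[OF A(2,1), of "col U i"] U(1) quadratic_form_diagonalised_col[OF U(1,2) that, of d] U(3) by simp
  thus ?thesis using that U by blast
qed

lemma pd_spectral:
  assumes A: "A \<in> carrier_mat n n" "pd A"
  obtains U d where "U \<in> carrier_mat n n" "unitary U" "A = U * rdiag n d * adj U" "\<And>i. i < n \<Longrightarrow> 0 < d i"
proof -
  obtain U d where U: "U \<in> carrier_mat n n" "unitary U" "A = U * rdiag n d * adj U"
    using spectral_theorem[OF A(1) pd_hermitian[OF A(2)]] by blast
  have "0 < d i" if "i < n" for i
    using pdD[OF A(2,1), of "col U i"] U(1) quadratic_form_diagonalised_col[OF U(1,2) that, of d] U(3)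
     unitary_col_nonzero[OF U(1,2) that] by simp
  thus ?thesis using that U by blast
qed

section \<open>Linear operations and the Loewner order through quadratic forms\<close>

lemma hermitian_add:
  "A \<in> carrier_mat n n \<Longrightarrow> B \<in> carrier_mat n n \<Longrightarrow> hermitian A \<Longrightarrow> hermitian B \<Longrightarrow> hermitian (A + B)"
  by (rule hermitianI[of _ n], simp add: minus_carrier_mat, rule eq_matI)
    (auto simp: hermitian_def mat_eq_iff)

lemma hermitian_minus:
  "A \<in> carrier_mat n n \<Longrightarrow> B \<in> carrier_mat n n \<Longrightarrow> hermitian A \<Longrightarrow> hermitian B \<Longrightarrow> hermitian (A - B)"
  by (rule hermitianI[of _ n], simp add: minus_carrier_mat, rule eq_matI)
    (auto simp: hermitian_def mat_eq_iff)

lemma hermitian_smult: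
  "A \<in> carrier_mat n n \<Longrightarrow> hermitian A \<Longrightarrow> hermitian (complex_of_real c \<cdot>\<^sub>m A)"
  by (rule hermitianI[of _ n], simp, rule eq_matI)
    (auto simp: hermitian_def mat_eq_iff)

lemma smult_mat_vec:
  "A \<in> carrier_mat n m \<Longrightarrow> v \<in> carrier_vec m \<Longrightarrow> ((c::complex) \<cdot>\<^sub>m A) *\<^sub>v v = c \<cdot>\<^sub>v (A *\<^sub>v v)"
  by (intro eq_vecI) auto

lemma quadratic_form_add:
  assumes "(A :: complex mat) \<in> carrier_mat n n" "B \<in> carrier_mat n n" "u \<in> carrier_vec n" "v \<in> carrier_vec n"
  shows "((A + B) *\<^sub>v u) \<bullet>c v = (A *\<^sub>v u) \<bullet>c v + (B *\<^sub>v u) \<bullet>c v"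
  unfolding add_mult_distrib_mat_vec[OF assms(1-3)] using assms by (intro cscalar_add_left[of _ n]) auto

lemma quadratic_form_minus:
  assumes "(A :: complex mat) \<in> carrier_mat n n" "B \<in> carrier_mat n n" "u \<in> carrier_vec n" "v \<in> carrier_vec n"
  shows "((A - B) *\<^sub>v u) \<bullet>c v = (A *\<^sub>v u) \<bullet>c v - (B *\<^sub>v u) \<bullet>c v"
  unfolding minus_mult_distrib_mat_vec[OF assms(1-3)] using assms by (intro cscalar_minus_left[of _ n]) auto

lemma quadratic_form_smult:
  assumes "(A :: complex mat) \<in> carrier_mat n n" "u \<in> carrier_vec n" "v \<in> carrier_vec n"
  shows "((c \<cdot>\<^sub>m A) *\<^sub>v u) \<bullet>c v = c * ((A *\<^sub>v u) \<bullet>c v)"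
  unfolding smult_mat_vec[OF assms(1,2)] using assms by (intro cscalar_smult_left[of _ n]) auto

lemma psd_add:
  assumes "A \<in> carrier_mat n n" "B \<in> carrier_mat n n" "psd A" "psd B"
  shows "psd (A + B)"
  using assms
  by (intro psdI[of _ n] hermitian_add[of _ n]) (auto simp: psd_hermitian quadratic_form_add[of _ n] psdD[of _ n])

lemma psd_smult:
  assumes "A \<in> carrier_mat n n" "psd A" "0 \<le> c"
  shows "psd (complex_of_real c \<cdot>\<^sub>m A)"
  using assms
  by (intro psdI[of _ n] hermitian_smult[of _ n]) (auto simp: psd_hermitian quadratic_form_smult[of _ n] psdD[of _ n])

lemma psd_zero: "psd (0\<^sub>m n n)"
proof (intro psdI[of _ n] hermitianI[of _ n])
  fix v :: "complex Matrix.vec" assume v: "v \<in> carrier_vec n"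
  hence "0\<^sub>m n n *\<^sub>v v = 0\<^sub>v n" by auto
  thus "0 \<le> Re ((0\<^sub>m n n *\<^sub>v v) \<bullet>c v)" using v by simp
qed auto

lemma loewner_leI:
  assumes "A \<in> carrier_mat n n" "B \<in> carrier_mat n n" "hermitian A" "hermitian B"
    "\<And>v. v \<in> carrier_vec n \<Longrightarrow> Re ((A *\<^sub>v v) \<bullet>c v) \<le> Re ((B *\<^sub>v v) \<bullet>c v)"
  shows "loewner_le A B"
  using assms unfolding loewner_le_def
  by (auto intro!: psdI[of _ n] hermitian_minus[of _ n] simp: quadratic_form_minus[of _ n])

lemma loewner_leD:
  assumes "A \<in> carrier_mat n n" "B \<in> carrier_mat n n" "loewner_le A B" "v \<in> carrier_vec n"
  shows "Re ((A *\<^sub>v v) \<bullet>c v) \<le> Re ((B *\<^sub>v v) \<bullet>c v)"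
  using psdD[of "B - A" n v] assms minus_carrier_mat[of A n n B] unfolding loewner_le_def
  by (auto simp: quadratic_form_minus[of _ n])

lemma loewner_le_trans:
  assumes "A \<in> carrier_mat n n" "B \<in> carrier_mat n n" "C \<in> carrier_mat n n"
    "hermitian A" "hermitian C" "loewner_le A B" "loewner_le B C"
  shows "loewner_le A C"
  using assms loewner_leD[OF assms(1,2,6)] loewner_leD[OF assms(2,3,7)]
  by (intro loewner_leI[of _ n]) (auto intro: order_trans)

lemma mfun_carrier:
  assumes "A \<in> carrier_mat n n" "hermitian A"
  shows "mfun f A \<in> carrier_mat n n" "hermitian (mfun f A)"
proof -
  obtain U d where U: "U \<in> carrier_mat n n" "unitary U" "A = U * rdiag n d * adj U"
    using spectral_theorem[OF assms] by blast
  show "mfun f A \<in> carrier_mat n n" "hermitian (mfun f A)"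
    unfolding mfun_diagonalised[OF U] using U(1) by (auto intro: hermitian_conj[of _ n])
qed

lemma mfun_psd:
  assumes "A \<in> carrier_mat n n" "pd A" "\<And>x. 0 < x \<Longrightarrow> 0 \<le> f x"
  shows "psd (mfun f A)"
proof -
  obtain U d where U: "U \<in> carrier_mat n n" "unitary U" "A = U * rdiag n d * adj U" "\<And>i. i < n \<Longrightarrow> 0 < d i"
    using pd_spectral[OF assms(1,2)] by blast
  show ?thesis unfolding mfun_diagonalised[OF U(1-3)]
    using U assms(3) by (intro psd_conj_rdiag) auto
qed

lemma mfun_pd:
  assumes "A \<in> carrier_mat n n" "pd A" "\<And>x. 0 < x \<Longrightarrow> 0 < f x"
  shows "pd (mfun f A)"
proof -
  obtain U d where U: "U \<in> carrier_mat n n" "unitary U" "A = U * rdiag n d * adj U" "\<And>i. i < n \<Longrightarrow> 0 < d i"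
    using pd_spectral[OF assms(1,2)] by blast
  show ?thesis unfolding mfun_diagonalised[OF U(1-3)]
    using U assms(3) by (intro pd_diagonalised) auto
qed

section \<open>Positive blocks and the geometric mean\<close>

lemma square_assoc:
  "A \<in> carrier_mat n n \<Longrightarrow> B \<in> carrier_mat n n \<Longrightarrow> C \<in> carrier_mat n n \<Longrightarrow> (A * B) * C = A * (B * (C :: complex mat))"
  by (rule assoc_mult_mat)

text \<open>This is positivity of [[X, adj Z], [Z, Y]] tested on (u, v); the two off-diagonal terms
  are conjugate, hence the factor 2. Quadratic forms avoid matrices of size 2n, and for hermitian
  \<open>Z\<close> this is the block of the overview.\<close>

definition psd_block :: "nat \<Rightarrow> complex mat \<Rightarrow> complex mat \<Rightarrow> complex mat \<Rightarrow> bool" where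
  "psd_block n X Z Y \<longleftrightarrow> X \<in> carrier_mat n n \<and> Z \<in> carrier_mat n n \<and> Y \<in> carrier_mat n n \<and>
     (\<forall>u\<in>carrier_vec n. \<forall>v\<in>carrier_vec n.
        0 \<le> Re ((X *\<^sub>v u) \<bullet>c u) + 2 * Re ((Z *\<^sub>v u) \<bullet>c v) + Re ((Y *\<^sub>v v) \<bullet>c v))"

lemma psd_block_carrier:
  "psd_block n X Z Y \<Longrightarrow> X \<in> carrier_mat n n \<and> Z \<in> carrier_mat n n \<and> Y \<in> carrier_mat n n"
  unfolding psd_block_def by blast

lemma psd_blockD:
  "psd_block n X Z Y \<Longrightarrow> u \<in> carrier_vec n \<Longrightarrow> v \<in> carrier_vec n \<Longrightarrow>
     0 \<le> Re ((X *\<^sub>v u) \<bullet>c u) + 2 * Re ((Z *\<^sub>v u) \<bullet>c v) + Re ((Y *\<^sub>v v) \<bullet>c v)"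
  unfolding psd_block_def by blast

lemma zero_mat_cscalar:
  "u \<in> carrier_vec n \<Longrightarrow> v \<in> carrier_vec n \<Longrightarrow> (0\<^sub>m n n *\<^sub>v u) \<bullet>c (v :: complex Matrix.vec) = 0"
  by (simp add: scalar_prod_def)

lemma psd_block_zero: "psd_block n (0\<^sub>m n n) (0\<^sub>m n n) (0\<^sub>m n n)"
  unfolding psd_block_def by (auto simp: zero_mat_cscalar)

lemma psd_block_add:
  assumes "psd_block n X Z Y" "psd_block n X' Z' Y'"
  shows "psd_block n (X + X') (Z + Z') (Y + Y')"
proof -
  have c: "X \<in> carrier_mat n n" "Z \<in> carrier_mat n n" "Y \<in> carrier_mat n n"
    "X' \<in> carrier_mat n n" "Z' \<in> carrier_mat n n" "Y' \<in> carrier_mat n n"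
    using assms psd_block_carrier by auto
  show ?thesis unfolding psd_block_def
  proof (intro conjI ballI)
    fix u v :: "complex Matrix.vec" assume uv: "u \<in> carrier_vec n" "v \<in> carrier_vec n"
    show "0 \<le> Re (((X + X') *\<^sub>v u) \<bullet>c u) + 2 * Re (((Z + Z') *\<^sub>v u) \<bullet>c v) + Re (((Y + Y') *\<^sub>v v) \<bullet>c v)"
      using psd_blockD[OF assms(1) uv] psd_blockD[OF assms(2) uv]
      unfolding quadratic_form_add[OF c(1,4) uv(1,1)] quadratic_form_add[OF c(2,5) uv]
        quadratic_form_add[OF c(3,6) uv(2,2)] by simp
  qed (use c in auto)
qed

lemma hermitian_form_swap:
  assumes "A \<in> carrier_mat n n" "hermitian A" "u \<in> carrier_vec n" "v \<in> carrier_vec n"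
  shows "Re ((A *\<^sub>v u) \<bullet>c v) = Re ((A *\<^sub>v v) \<bullet>c u)"
proof -
  have "(A *\<^sub>v u) \<bullet>c v = u \<bullet>c (A *\<^sub>v v)"
    using cscalar_adjoint[OF assms(1,3,4)] hermitian_adjoint[OF assms(2)] by simp
  also have "\<dots> = cnj ((A *\<^sub>v v) \<bullet>c u)"
    using assms by (intro cscalar_commute[of _ n]) auto
  finally show ?thesis by simp
qed

text \<open>Completing the square: the form equals that of \<open>P\<close> at u + a v.\<close>

lemma psd_block_geometric:
  assumes P: "P \<in> carrier_mat n n" "psd P"
  shows "psd_block n P (complex_of_real a \<cdot>\<^sub>m P) (complex_of_real (a\<^sup>2) \<cdot>\<^sub>m P)"
  unfolding psd_block_def
proof (intro conjI ballI)
  fix u v :: "complex Matrix.vec" assume uv: "u \<in> carrier_vec n" "v \<in> carrier_vec n"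
  let ?av = "complex_of_real a \<cdot>\<^sub>v v"
  have av: "?av \<in> carrier_vec n" "P *\<^sub>v u \<in> carrier_vec n" "P *\<^sub>v v \<in> carrier_vec n" using uv P by auto
  have "(P *\<^sub>v (u + ?av)) \<bullet>c (u + ?av) = (P *\<^sub>v u + complex_of_real a \<cdot>\<^sub>v (P *\<^sub>v v)) \<bullet>c (u + ?av)"
    using P uv av by (simp add: mult_add_distrib_mat_vec[of _ n n] mult_mat_vec[of _ n n])
  also have "\<dots> = (P *\<^sub>v u) \<bullet>c u + complex_of_real a * ((P *\<^sub>v u) \<bullet>c v)
      + complex_of_real a * ((P *\<^sub>v v) \<bullet>c u) + complex_of_real (a\<^sup>2) * ((P *\<^sub>v v) \<bullet>c v)"
    using P uv av by (simp add: cscalar_add_left[of _ n] cscalar_add_right[of _ n] cscalar_smult_left[of _ n]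
      cscalar_smult_right[of _ n] power2_eq_square algebra_simps)
  finally have "Re ((P *\<^sub>v (u + ?av)) \<bullet>c (u + ?av)) = Re ((P *\<^sub>v u) \<bullet>c u) + 2 * (a * Re ((P *\<^sub>v u) \<bullet>c v))
      + a\<^sup>2 * Re ((P *\<^sub>v v) \<bullet>c v)"
    using hermitian_form_swap[OF P(1) psd_hermitian[OF P(2)] uv] by simp
  moreover have "0 \<le> Re ((P *\<^sub>v (u + ?av)) \<bullet>c (u + ?av))"
    using psdD[OF P(2,1)] uv av by simp
  ultimately show "0 \<le> Re ((P *\<^sub>v u) \<bullet>c u) + 2 * Re ((complex_of_real a \<cdot>\<^sub>m P *\<^sub>v u) \<bullet>c v) +
      Re ((complex_of_real (a\<^sup>2) \<cdot>\<^sub>m P *\<^sub>v v) \<bullet>c v)"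
    unfolding quadratic_form_smult[OF P(1) uv] quadratic_form_smult[OF P(1) uv(2,2)] by simp
qed (use P in auto)

lemma psd_block_diagonal:
  assumes "psd_block n X Z Y" and v: "v \<in> carrier_vec n"
  shows "2 * Re ((Z *\<^sub>v v) \<bullet>c v) \<le> Re ((X *\<^sub>v v) \<bullet>c v) + Re ((Y *\<^sub>v v) \<bullet>c v)"
proof -
  have c: "X \<in> carrier_mat n n" "Z \<in> carrier_mat n n" "Y \<in> carrier_mat n n"
    using assms psd_block_carrier by auto
  let ?w = "(-1) \<cdot>\<^sub>v v"
  have w: "?w \<in> carrier_vec n" using v by simp
  have "(Z *\<^sub>v v) \<bullet>c ?w = - ((Z *\<^sub>v v) \<bullet>c v)" "(Y *\<^sub>v ?w) \<bullet>c ?w = (Y *\<^sub>v v) \<bullet>c v"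
    using v c by (simp_all add: mult_mat_vec[of _ n n] cscalar_smult_left[of _ n] cscalar_smult_right[of _ n])
  thus ?thesis using psd_blockD[OF assms(1) v w] by simp
qed

text \<open>The inductive form lets a multilinear expansion split off one summand at a time. The
  condition \<open>0 \<le> a\<close> makes the middle entry positive semidefinite, so that its image
  under a positive map is hermitian.\<close>

inductive geometric_triple :: "nat \<Rightarrow> complex mat \<Rightarrow> complex mat \<Rightarrow> complex mat \<Rightarrow> bool" for n where
  zero: "geometric_triple n (0\<^sub>m n n) (0\<^sub>m n n) (0\<^sub>m n n)"
| add: "geometric_triple n X Z Y \<Longrightarrow> S \<in> carrier_mat n n \<Longrightarrow> psd S \<Longrightarrow> 0 \<le> a \<Longrightarrow>
    geometric_triple n (X + S) (Z + complex_of_real a \<cdot>\<^sub>m S) (Y + complex_of_real (a\<^sup>2) \<cdot>\<^sub>m S)"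

lemma geometric_triple_psd:
  assumes "geometric_triple n X Z Y"
  shows "X \<in> carrier_mat n n \<and> Z \<in> carrier_mat n n \<and> Y \<in> carrier_mat n n \<and> psd X \<and> psd Z \<and> psd Y"
  using assms
proof induction
  case zero
  then show ?case by (auto simp: psd_zero)
next
  case (add X Z Y S a)
  then show ?case using psd_smult[OF add.hyps(2,3)] by (auto intro!: psd_add[of _ n] simp del: of_real_power)
qed

lemma geometric_triple_psd_block: "geometric_triple n X Z Y \<Longrightarrow> psd_block n X Z Y"
  by (induction rule: geometric_triple.induct) (auto intro: psd_block_zero psd_block_add psd_block_geometric simp del: of_real_power)

text \<open>The diagonal unit at \<open>q\<close> contributes the positive summand
  \<open>T * E q * adj T\<close>, with coefficient \<open>a q\<close>. It serves all three entries,
  since their diagonal parts are 1, \<open>a\<close> and the square of \<open>a\<close>.\<close>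

lemma geometric_triple_congruence:
  assumes T: "T \<in> carrier_mat n n" and a: "\<And>i. i < n \<Longrightarrow> 0 \<le> a i"
  shows "geometric_triple n (T * adj T) (T * rdiag n a * adj T) (T * rdiag n (\<lambda>i. (a i)\<^sup>2) * adj T)"
proof -
  define D where "D q w = rdiag n (\<lambda>i. if i < q then w i else 0)" for q and w :: "nat \<Rightarrow> real"
  define E where "E q = rdiag n (\<lambda>i. if i = q then 1 else 0)" for q :: nat
  have c: "D q w \<in> carrier_mat n n" "E q \<in> carrier_mat n n" for q w unfolding D_def E_def by auto
  have Suc: "T * D (Suc q) w * adj T = T * D q w * adj T + complex_of_real (w q) \<cdot>\<^sub>m (T * E q * adj T)" for q w
  proof -
    have "D (Suc q) w = D q w + complex_of_real (w q) \<cdot>\<^sub>m E q"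
      unfolding D_def E_def by (rule eq_matI) (auto simp: mat_diag_def less_Suc_eq)
    thus ?thesis using T c[of q]
      by (simp add: mult_add_distrib_mat[of _ n n _ n] add_mult_distrib_mat[of _ n n _ _ n]
        mult_smult_distrib[of _ n n _ n] mult_smult_assoc_mat[of _ n n _ n])
  qed
  have "geometric_triple n (T * D q (\<lambda>_. 1) * adj T) (T * D q a * adj T) (T * D q (\<lambda>i. (a i)\<^sup>2) * adj T)"
    if "q \<le> n" for q
    using that
  proof (induction q)
    case 0
    have "D 0 w = 0\<^sub>m n n" for w unfolding D_def by (rule eq_matI) (auto simp: mat_diag_def)
    then show ?case using T geometric_triple.zero[of n]
      by (simp add: right_mult_zero_mat[of _ n n] left_mult_zero_mat[of _ n n])
  next
    case (Suc q)
    have "psd (T * E q * adj T)" unfolding E_def using T by (intro psd_conj_rdiag) auto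
    moreover have "T * E q * adj T \<in> carrier_mat n n" using T c by simp
    moreover have "complex_of_real 1 \<cdot>\<^sub>m (T * E q * adj T) = T * E q * adj T" by (intro eq_matI) auto
    ultimately show ?case using geometric_triple.add[OF Suc.IH, of "T * E q * adj T" "a q"] Suc.prems a[of q]
      unfolding \<open>\<And>w q. T * D (Suc q) w * adj T = _\<close> by simp
  qed
  from this[of n] have "geometric_triple n (T * D n (\<lambda>_. 1) * adj T) (T * D n a * adj T) (T * D n (\<lambda>i. (a i)\<^sup>2) * adj T)"
    by simp
  moreover have "D n w = rdiag n w" for w unfolding D_def by (rule eq_matI) (auto simp: mat_diag_def)
  ultimately show ?thesis using T by simp
qed

section \<open>Simultaneous diagonalisation and maximality of the geometric mean\<close>

lemma psd_conj:
  assumes A: "A \<in> carrier_mat n n" "psd A" and T: "T \<in> carrier_mat n n"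
  shows "psd (T * A * adj T)"
proof (intro psdI[of _ n] hermitian_conj[of _ n])
  fix v :: "complex Matrix.vec" assume v: "v \<in> carrier_vec n"
  have "((T * A * adj T) *\<^sub>v v) \<bullet>c v = (T *\<^sub>v (A *\<^sub>v (adj T *\<^sub>v v))) \<bullet>c v"
    using A T v by (simp add: assoc_mult_mat_vec[of _ n n _ n])
  also have "\<dots> = (A *\<^sub>v (adj T *\<^sub>v v)) \<bullet>c (adj T *\<^sub>v v)"
    using A T v by (intro cscalar_adjoint[of _ n n]) auto
  finally show "0 \<le> Re (((T * A * adj T) *\<^sub>v v) \<bullet>c v)"
    using psdD[OF A(2,1), of "adj T *\<^sub>v v"] T v by simp
qed (use A T psd_hermitian in auto)

text \<open>Let \<open>R\<close> and \<open>Q\<close> be the powers 1/2 and -1/2 of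
  \<open>X\<close>, and diagonalise \<open>C = Q * Y * Q\<close> by \<open>V\<close> with
  eigenvalues \<open>c i\<close>. Then \<open>T = R * V\<close> has inverse
  \<open>S = adj V * Q\<close>, and congruence by \<open>T\<close> carries the diagonal matrices of
  1, \<open>c\<close> and \<open>sqrt (c i)\<close> to \<open>X\<close>, \<open>Y\<close> and the
  mean, so \<open>a i = sqrt (c i)\<close>. Later facts about positive definite pairs start from
  this form instead of \<open>gmean_def\<close>.\<close>

lemma gmean_congruence:
  assumes X: "X \<in> carrier_mat n n" "pd X" and Y: "Y \<in> carrier_mat n n" "pd Y"
  obtains T S a where "T \<in> carrier_mat n n" "S \<in> carrier_mat n n" "T * S = 1\<^sub>m n" "S * T = 1\<^sub>m n"
    "\<And>i. i < n \<Longrightarrow> 0 < a i" "X = T * adj T" "Y = T * rdiag n (\<lambda>i. (a i)\<^sup>2) * adj T"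
    "gmean X Y = T * rdiag n a * adj T"
proof -
  obtain U d where U: "U \<in> carrier_mat n n" "unitary U" "X = U * rdiag n d * adj U" "\<And>i. i < n \<Longrightarrow> 0 < d i"
    using pd_spectral[OF X] by blast
  define R where "R = U * rdiag n (\<lambda>i. sqrt (d i)) * adj U"
  define Q where "Q = U * rdiag n (\<lambda>i. d i powr (-1/2)) * adj U"
  have R: "R \<in> carrier_mat n n" "adj R = R" and Q: "Q \<in> carrier_mat n n" "adj Q = Q"
    unfolding R_def Q_def using U(1) hermitian_adjoint[OF hermitian_conj[OF _ hermitian_rdiag U(1)]] by simp_all
  have sq: "sqrt (d i) * sqrt (d i) = d i" "sqrt (d i) * d i powr (-1/2) = 1" if "i < n" for i
    using U(4)[OF that] by (auto simp: powr_half_sqrt[symmetric] powr_add[symmetric])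
  have cong: "rdiag n b = rdiag n c" if "\<And>i. i < n \<Longrightarrow> b i = c i" for b c
    by (rule eq_matI) (use that in \<open>auto simp: mat_diag_def\<close>)
  have RR: "R * R = X" unfolding R_def U(3) unitary_conj_rdiag_mult[OF U(1,2)]
    using sq(1) cong[of "\<lambda>i. sqrt (d i) * sqrt (d i)" d] by simp
  have RQ: "R * Q = 1\<^sub>m n" unfolding R_def Q_def unitary_conj_rdiag_mult[OF U(1,2)]
    using sq(2) cong[of "\<lambda>i. sqrt (d i) * d i powr (-1/2)" "\<lambda>_. 1"] U(1,2) by (simp add: unitary_right_inverse)
  have QR: "Q * R = 1\<^sub>m n" by (rule mat_mult_left_right_inverse[OF R(1) Q(1) RQ])
  define C where "C = Q * Y * Q"
  have C: "C \<in> carrier_mat n n" unfolding C_def using Q Y by simp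
  have "pd C"
  proof (rule pdI[OF C])
    show "hermitian C" unfolding C_def using hermitian_conj[OF Y(1) pd_hermitian[OF Y(2)] Q(1)] Q(2) by simp
    fix v :: "complex Matrix.vec" assume v: "v \<in> carrier_vec n" "v \<noteq> 0\<^sub>v n"
    have "Q *\<^sub>v v \<noteq> 0\<^sub>v n"
    proof
      assume "Q *\<^sub>v v = 0\<^sub>v n"
      hence "R *\<^sub>v (Q *\<^sub>v v) = 0\<^sub>v n" using R by auto
      moreover have "R *\<^sub>v (Q *\<^sub>v v) = v"
        using R Q v RQ by (simp flip: assoc_mult_mat_vec[of _ n n _ n])
      ultimately show False using v by simp
    qed
    have "(C *\<^sub>v v) \<bullet>c v = (Q *\<^sub>v (Y *\<^sub>v (Q *\<^sub>v v))) \<bullet>c v"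
      unfolding C_def using Q Y v by (simp add: assoc_mult_mat_vec[of _ n n _ n])
    also have "\<dots> = (Y *\<^sub>v (Q *\<^sub>v v)) \<bullet>c (adj Q *\<^sub>v v)"
      using Q Y v by (intro cscalar_adjoint[of _ n n]) auto
    finally show "0 < Re ((C *\<^sub>v v) \<bullet>c v)"
      using pdD[OF Y(2,1) _ \<open>Q *\<^sub>v v \<noteq> 0\<^sub>v n\<close>] Q v by simp
  qed
  then obtain V c where V: "V \<in> carrier_mat n n" "unitary V" "C = V * rdiag n c * adj V" "\<And>i. i < n \<Longrightarrow> 0 < c i"
    using pd_spectral[OF C] by blast
  define T where "T = R * V"
  define S where "S = adj V * Q"
  have T: "T \<in> carrier_mat n n" "adj T = adj V * R" and S: "S \<in> carrier_mat n n"
    unfolding T_def S_def using R Q V(1) by (auto simp: adjoint_mult[of _ n n _ n])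
  have T_conj: "T * M * adj T = R * (V * M * adj V) * R" if "M \<in> carrier_mat n n" for M
    unfolding T(2) unfolding T_def using R(1) V(1) that by (simp add: square_assoc[of _ n])
  have "T * S = R * (V * adj V) * Q" "S * T = adj V * (Q * R) * V"
    unfolding T_def S_def using R(1) Q(1) V(1) by (simp_all add: square_assoc[of _ n])
  hence inv: "T * S = 1\<^sub>m n" "S * T = 1\<^sub>m n"
    using R(1) V(1,2) RQ QR by (simp_all add: unitary_right_inverse)
  have "X = T * adj T"
    using T_conj[of "1\<^sub>m n"] T(1) V(1,2) R(1) RR by (simp add: unitary_right_inverse)
  moreover have "Y = T * rdiag n (\<lambda>i. (sqrt (c i))\<^sup>2) * adj T"
  proof -
    have "rdiag n (\<lambda>i. (sqrt (c i))\<^sup>2) = rdiag n c" using V(4) by (intro cong) (auto simp: less_imp_le)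
    hence "T * rdiag n (\<lambda>i. (sqrt (c i))\<^sup>2) * adj T = R * C * R" using T_conj V(3) by simp
    also have "\<dots> = (R * Q) * Y * (Q * R)"
      unfolding C_def using R(1) Q(1) Y(1) by (simp add: square_assoc[of _ n])
    finally show ?thesis using RQ QR Y(1) by simp
  qed
  moreover have "gmean X Y = T * rdiag n (\<lambda>i. sqrt (c i)) * adj T"
  proof -
    have "mfun sqrt X = R" "mfun (\<lambda>x. x powr (-1/2)) X = Q"
      unfolding R_def Q_def by (rule mfun_diagonalised[OF U(1-3)])+
    moreover have "mfun sqrt C = V * rdiag n (\<lambda>i. sqrt (c i)) * adj V"
      by (rule mfun_diagonalised[OF V(1-3)])
    ultimately show ?thesis unfolding gmean_def using T_conj by (simp add: C_def)
  qed
  ultimately show ?thesis using that[OF T(1) S inv, of "\<lambda>i. sqrt (c i)"] V(4) by simp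
qed

lemma vec_diff_swap:
  assumes "(x :: complex Matrix.vec) \<in> carrier_vec n" "y \<in> carrier_vec n" "z \<in> carrier_vec n" "x - y = z"
  shows "y = x - z"
proof (rule eq_vecI)
  fix i assume "i < dim_vec (x - z)"
  thus "y $ i = (x - z) $ i"
    using arg_cong[OF assms(4), of "\<lambda>v. v $ i"] assms(1-3) by (auto simp: algebra_simps)
qed (use assms in auto)

text \<open>After the congruence by \<open>S\<close> the block becomes \<open>(1, K, D\<^sup>2)\<close>, so \<open>K\<^sup>2 \<le> D\<^sup>2\<close>.  A unit eigenvector \<open>v\<close> of
  \<open>D - K\<close> with eigenvalue \<open>e < 0\<close> would give \<open>\<parallel>K v\<parallel>\<^sup>2 = \<parallel>D v\<parallel>\<^sup>2 - 2 e \<langle>D v, v\<rangle> + e\<^sup>2 > \<parallel>D v\<parallel>\<^sup>2\<close>.\<close>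
lemma psd_block_maximal:
  assumes blk: "psd_block n X Z Y" and hZ: "hermitian Z"
    and T: "T \<in> carrier_mat n n" and S: "S \<in> carrier_mat n n" and inv: "T * S = 1\<^sub>m n" "S * T = 1\<^sub>m n"
    and a: "\<And>i. i < n \<Longrightarrow> 0 \<le> a i"
    and X: "X = T * adj T" and Y: "Y = T * rdiag n (\<lambda>i. (a i)\<^sup>2) * adj T"
  shows "loewner_le Z (T * rdiag n a * adj T)"
proof -
  have Z: "Z \<in> carrier_mat n n" using psd_block_carrier[OF blk] by simp
  define D where "D = rdiag n a"
  define K where "K = S * Z * adj S"
  have D: "D \<in> carrier_mat n n" "adj D = D" "hermitian D" unfolding D_def by simp_all
  have K: "K \<in> carrier_mat n n" "hermitian K" unfolding K_def using S Z hZ by (auto intro: hermitian_conj[of _ n])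
  have DK: "D - K \<in> carrier_mat n n" using D K by (simp add: minus_carrier_mat)
  have adj_inv: "adj T * adj S = 1\<^sub>m n" "adj S * adj T = 1\<^sub>m n"
    using arg_cong[OF inv(2), of adj] arg_cong[OF inv(1), of adj] S T by (simp_all add: adjoint_mult[of _ n n _ n])
  have TS: "adj T *\<^sub>v (adj S *\<^sub>v w) = w" if "w \<in> carrier_vec n" for w
    using that S T adj_inv(1) by (simp flip: assoc_mult_mat_vec[of _ n n _ n])
  have key: "Re ((K *\<^sub>v v) \<bullet>c (K *\<^sub>v v)) \<le> Re ((D *\<^sub>v v) \<bullet>c (D *\<^sub>v v))" if v: "v \<in> carrier_vec n" for v
  proof -
    \<comment> \<open>In the congruent coordinates the form is |w|^2 + 2 Re <K w, v> + |D v|^2,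
      whose minimum over w is attained at - K v. Applying \<open>adj S\<close> returns to the
      original coordinates.\<close>
    define w where "w = (-1) \<cdot>\<^sub>v (K *\<^sub>v v)"
    define u where "u = adj S *\<^sub>v w"
    define v' where "v' = adj S *\<^sub>v v"
    have w: "w \<in> carrier_vec n" "u \<in> carrier_vec n" "v' \<in> carrier_vec n" "K *\<^sub>v v \<in> carrier_vec n"
      unfolding w_def u_def v'_def using K v S by auto
    have "(X *\<^sub>v u) \<bullet>c u = (T *\<^sub>v (adj T *\<^sub>v u)) \<bullet>c u"
      unfolding X using T w by (simp add: assoc_mult_mat_vec[of _ n n _ n])
    also have "\<dots> = (adj T *\<^sub>v u) \<bullet>c (adj T *\<^sub>v u)" using T w by (intro cscalar_adjoint[of _ n n]) auto
    also have "\<dots> = w \<bullet>c w" unfolding u_def TS[OF w(1)] ..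
    also have "\<dots> = (K *\<^sub>v v) \<bullet>c (K *\<^sub>v v)"
      unfolding w_def using w by (simp add: cscalar_smult_left[of _ n] cscalar_smult_right[of _ n])
    finally have 1: "(X *\<^sub>v u) \<bullet>c u = (K *\<^sub>v v) \<bullet>c (K *\<^sub>v v)" .
    have "(Z *\<^sub>v u) \<bullet>c v' = (S *\<^sub>v (Z *\<^sub>v u)) \<bullet>c v"
      unfolding v'_def using S Z w v by (intro cscalar_adjoint[symmetric, of _ n n]) auto
    also have "S *\<^sub>v (Z *\<^sub>v u) = K *\<^sub>v w"
      unfolding K_def u_def using S Z w by (simp add: assoc_mult_mat_vec[of _ n n _ n])
    also have "(K *\<^sub>v w) \<bullet>c v = w \<bullet>c (adj K *\<^sub>v v)" using K w v by (intro cscalar_adjoint[of _ n n]) auto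
    also have "\<dots> = - ((K *\<^sub>v v) \<bullet>c (K *\<^sub>v v))"
      unfolding w_def hermitian_adjoint[OF K(2)] using w by (simp add: cscalar_smult_left[of _ n])
    finally have 2: "(Z *\<^sub>v u) \<bullet>c v' = - ((K *\<^sub>v v) \<bullet>c (K *\<^sub>v v))" .
    have "Y = T * (D * D) * adj T" unfolding Y D_def by (simp add: power2_eq_square)
    hence "Y *\<^sub>v v' = T *\<^sub>v (D *\<^sub>v (D *\<^sub>v (adj T *\<^sub>v v')))"
      using T D w by (simp add: assoc_mult_mat_vec[of _ n n _ n])
    hence "(Y *\<^sub>v v') \<bullet>c v' = (T *\<^sub>v (D *\<^sub>v (D *\<^sub>v v))) \<bullet>c v'" unfolding v'_def TS[OF v] by simp
    also have "\<dots> = (D *\<^sub>v (D *\<^sub>v v)) \<bullet>c (adj T *\<^sub>v v')"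
      using T D w v by (intro cscalar_adjoint[of _ n n]) auto
    also have "\<dots> = (D *\<^sub>v v) \<bullet>c (adj D *\<^sub>v v)"
      unfolding v'_def TS[OF v] using D v by (intro cscalar_adjoint[of _ n n]) auto
    finally have 3: "(Y *\<^sub>v v') \<bullet>c v' = (D *\<^sub>v v) \<bullet>c (D *\<^sub>v v)" using D by simp
    show ?thesis using psd_blockD[OF blk w(2,3)] unfolding 1 2 3 by simp
  qed
  obtain U e where U: "U \<in> carrier_mat n n" "unitary U" "D - K = U * rdiag n e * adj U"
    using spectral_theorem[OF DK hermitian_minus[OF D(1) K(1) D(3) K(2)]] by blast
  have "0 \<le> e i" if i: "i < n" for i
  proof (rule ccontr)
    assume neg: "\<not> 0 \<le> e i"
    let ?v = "col U i"
    have v: "?v \<in> carrier_vec n" using U by simp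
    have "rdiag n e *\<^sub>v unit_vec n i = complex_of_real (e i) \<cdot>\<^sub>v unit_vec n i"
      using i by (intro eq_vecI) (auto simp: mat_diag_def)
    moreover have "U *\<^sub>v unit_vec n i = ?v" using U(1) i by (intro eq_vecI) auto
    ultimately have "(D - K) *\<^sub>v ?v = complex_of_real (e i) \<cdot>\<^sub>v ?v"
      unfolding U(3) using U(1,2) i v
      by (simp add: assoc_mult_mat_vec[of _ n n _ n] unitary_adjoint_col mult_mat_vec[of _ n n])
    hence "D *\<^sub>v ?v - K *\<^sub>v ?v = complex_of_real (e i) \<cdot>\<^sub>v ?v"
      using minus_mult_distrib_mat_vec[OF D(1) K(1) v] by simp
    hence Kv: "K *\<^sub>v ?v = D *\<^sub>v ?v - complex_of_real (e i) \<cdot>\<^sub>v ?v"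
      using D K v by (intro vec_diff_swap[of _ n]) auto
    have c: "D *\<^sub>v ?v \<in> carrier_vec n" "complex_of_real (e i) \<cdot>\<^sub>v ?v \<in> carrier_vec n" using D v by auto
    have sw: "Re (?v \<bullet>c (D *\<^sub>v ?v)) = Re ((D *\<^sub>v ?v) \<bullet>c ?v)"
      using cscalar_commute[OF v c(1)] by simp
    have "Re ((K *\<^sub>v ?v) \<bullet>c (K *\<^sub>v ?v)) = Re ((D *\<^sub>v ?v) \<bullet>c (D *\<^sub>v ?v))
        - 2 * e i * Re ((D *\<^sub>v ?v) \<bullet>c ?v) + (e i)\<^sup>2 * Re (?v \<bullet>c ?v)"
      unfolding Kv using v c sw
      by (simp add: cscalar_minus_left[of _ n] cscalar_minus_right[of _ n] cscalar_smult_left[of _ n]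
        cscalar_smult_right[of _ n] power2_eq_square algebra_simps)
    hence "(e i)\<^sup>2 * Re (?v \<bullet>c ?v) \<le> 2 * (e i * Re ((D *\<^sub>v ?v) \<bullet>c ?v))" using key[OF v] by simp
    moreover have "0 < (e i)\<^sup>2 * Re (?v \<bullet>c ?v)"
      using neg cscalar_self_pos[OF v unitary_col_nonzero[OF U(1,2) i]] by simp
    moreover have "psd D" using psd_conj_rdiag[of "1\<^sub>m n" n a] a unfolding D_def by simp
    hence "e i * Re ((D *\<^sub>v ?v) \<bullet>c ?v) \<le> 0"
      using neg psdD[OF _ D(1) v] by (intro mult_nonpos_nonneg) auto
    ultimately show False by simp
  qed
  hence "psd (D - K)" unfolding U(3) using U(1) by (intro psd_conj_rdiag)
  hence "psd (T * (D - K) * adj T)" by (rule psd_conj[OF DK _ T])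
  moreover have "T * (D - K) * adj T = T * D * adj T - T * K * adj T"
    using T D K by (simp add: mult_minus_distrib_mat[of _ n n _ n] minus_mult_distrib_mat[of _ n n _ _ n])
  moreover have "T * K * adj T = (T * S) * Z * (adj S * adj T)"
    unfolding K_def using T S Z by (simp add: square_assoc[of _ n])
  hence "T * K * adj T = Z" using inv adj_inv Z by simp
  ultimately show ?thesis unfolding loewner_le_def D_def using T Z by auto
qed

theorem psd_block_le_gmean:
  assumes "psd_block n X Z Y" "hermitian Z" "pd X" "pd Y"
  shows "loewner_le Z (gmean X Y)"
proof -
  have c: "X \<in> carrier_mat n n" "Y \<in> carrier_mat n n" using psd_block_carrier[OF assms(1)] by auto
  obtain T S a where T: "T \<in> carrier_mat n n" "S \<in> carrier_mat n n" "T * S = 1\<^sub>m n" "S * T = 1\<^sub>m n"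
    "\<And>i. i < n \<Longrightarrow> 0 < a i" "X = T * adj T" "Y = T * rdiag n (\<lambda>i. (a i)\<^sup>2) * adj T"
    "gmean X Y = T * rdiag n a * adj T"
    using gmean_congruence[OF c(1) assms(3) c(2) assms(4)] by blast
  show ?thesis unfolding T(8)
    by (rule psd_block_maximal[OF assms(1,2) T(1-4) less_imp_le[OF T(5)] T(6,7)])
qed

theorem gmean_geometric_triple:
  assumes X: "X \<in> carrier_mat n n" "pd X" and Y: "Y \<in> carrier_mat n n" "pd Y"
  shows "geometric_triple n X (gmean X Y) Y"
proof -
  obtain T S a where T: "T \<in> carrier_mat n n" "S \<in> carrier_mat n n" "T * S = 1\<^sub>m n" "S * T = 1\<^sub>m n"
    "\<And>i. i < n \<Longrightarrow> 0 < a i" "X = T * adj T" "Y = T * rdiag n (\<lambda>i. (a i)\<^sup>2) * adj T"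
    "gmean X Y = T * rdiag n a * adj T"
    using gmean_congruence[OF assms] by blast
  show ?thesis
    using geometric_triple_congruence[OF T(1), of a, OF less_imp_le[OF T(5)]]
    unfolding T(8) T(6)[symmetric] T(7)[symmetric] .
qed

section \<open>Inverses\<close>

lemma minv_eqI:
  assumes "A \<in> carrier_mat n n" "B \<in> carrier_mat n n" "A * B = 1\<^sub>m n"
  shows "minv A = B"
proof -
  have BA: "B * A = 1\<^sub>m n" by (rule mat_mult_left_right_inverse[OF assms])
  show ?thesis unfolding minv_def
  proof (rule the_equality)
    fix C assume "C \<in> carrier_mat (dim_row A) (dim_row A) \<and> A * C = 1\<^sub>m (dim_row A) \<and> C * A = 1\<^sub>m (dim_row A)"
    hence C: "C \<in> carrier_mat n n" "C * A = 1\<^sub>m n" using assms(1) by auto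
    have "C = C * (A * B)" using C assms by simp
    also have "\<dots> = (C * A) * B" using square_assoc[OF C(1) assms(1,2)] by simp
    also have "\<dots> = B" using C assms by simp
    finally show "C = B" .
  qed (use assms BA in auto)
qed

lemma pd_minv:
  assumes "A \<in> carrier_mat n n" "pd A"
  shows "minv A \<in> carrier_mat n n" "pd (minv A)" "A * minv A = 1\<^sub>m n" "minv A * A = 1\<^sub>m n"
proof -
  obtain U d where U: "U \<in> carrier_mat n n" "unitary U" "A = U * rdiag n d * adj U" "\<And>i. i < n \<Longrightarrow> 0 < d i"
    using pd_spectral[OF assms] by blast
  let ?B = "U * rdiag n (\<lambda>i. 1 / d i) * adj U"
  have "rdiag n (\<lambda>i. d i * (1 / d i)) = 1\<^sub>m n"
    by (rule eq_matI) (use U(4) in \<open>auto simp: mat_diag_def less_imp_neq[symmetric]\<close>)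
  hence AB: "A * ?B = 1\<^sub>m n" unfolding U(3) unitary_conj_rdiag_mult[OF U(1,2)]
    using U(1,2) by (simp add: unitary_right_inverse del: of_real_mult of_real_divide)
  have m: "minv A = ?B" using minv_eqI[OF assms(1) _ AB] U(1) by simp
  show 1: "minv A \<in> carrier_mat n n" "pd (minv A)" "A * minv A = 1\<^sub>m n"
    unfolding m using AB U(1) pd_diagonalised[OF U(1,2), of "\<lambda>i. 1 / d i"] U(4) by simp_all
  show "minv A * A = 1\<^sub>m n" by (rule mat_mult_left_right_inverse[OF assms(1) 1(1,3)])
qed

text \<open>Expanding \<open>0 \<le> \<langle>Z (y - x), y - x\<rangle>\<close> at \<open>x = W\<inverse> v\<close>, \<open>y = Z\<inverse> v\<close>.\<close>
lemma minv_antimono: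
  assumes Z: "Z \<in> carrier_mat n n" "pd Z" and W: "W \<in> carrier_mat n n" "pd W" and le: "loewner_le Z W"
  shows "loewner_le (minv W) (minv Z)"
proof (rule loewner_leI[of _ n])
  note mZ = pd_minv[OF Z] and mW = pd_minv[OF W]
  fix v :: "complex Matrix.vec" assume v: "v \<in> carrier_vec n"
  define x where "x = minv W *\<^sub>v v"
  define y where "y = minv Z *\<^sub>v v"
  have xy: "x \<in> carrier_vec n" "y \<in> carrier_vec n" unfolding x_def y_def using mZ mW v by auto
  have Zy: "Z *\<^sub>v y = v" unfolding y_def using Z mZ v by (simp flip: assoc_mult_mat_vec[of _ n n _ n])
  have Wx: "W *\<^sub>v x = v" unfolding x_def using W mW v by (simp flip: assoc_mult_mat_vec[of _ n n _ n])
  have c: "Z *\<^sub>v x \<in> carrier_vec n" "y - x \<in> carrier_vec n" using Z xy by auto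
  have sw: "Re (v \<bullet>c x) = Re (x \<bullet>c v)" "Re (v \<bullet>c y) = Re (y \<bullet>c v)"
    using cscalar_commute[OF v xy(1)] cscalar_commute[OF v xy(2)] by auto
  have Zxy: "Re ((Z *\<^sub>v x) \<bullet>c y) = Re (v \<bullet>c x)"
    using hermitian_form_swap[OF Z(1) pd_hermitian[OF Z(2)] xy] Zy by simp
  have "0 \<le> Re ((Z *\<^sub>v (y - x)) \<bullet>c (y - x))" by (rule psdD[OF pd_imp_psd[OF Z(2)] Z(1) c(2)])
  also have "(Z *\<^sub>v (y - x)) \<bullet>c (y - x) = (v - Z *\<^sub>v x) \<bullet>c (y - x)"
    using mult_minus_distrib_mat_vec[OF Z(1) xy(2,1)] Zy by simp
  also have "Re \<dots> = Re (v \<bullet>c y) - 2 * Re (v \<bullet>c x) + Re ((Z *\<^sub>v x) \<bullet>c x)"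
    using v c xy Zxy by (simp add: cscalar_minus_left[of _ n] cscalar_minus_right[of _ n])
  also have "Re ((Z *\<^sub>v x) \<bullet>c x) \<le> Re ((W *\<^sub>v x) \<bullet>c x)" by (rule loewner_leD[OF Z(1) W(1) le xy(1)])
  finally have "Re (v \<bullet>c x) \<le> Re (v \<bullet>c y)" unfolding Wx by simp
  thus "Re ((minv W *\<^sub>v v) \<bullet>c v) \<le> Re ((minv Z *\<^sub>v v) \<bullet>c v)" using sw unfolding x_def y_def by simp
qed (use pd_minv[OF Z] pd_minv[OF W] pd_hermitian in auto)

lemma gmean_carrier:
  assumes X: "X \<in> carrier_mat n n" "pd X" and Y: "Y \<in> carrier_mat n n" "pd Y"
  shows "gmean X Y \<in> carrier_mat n n" "hermitian (gmean X Y)"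
  using geometric_triple_psd[OF gmean_geometric_triple[OF assms]] psd_hermitian by auto

text \<open>Inverting the congruence puts \<open>minv X\<close>, \<open>minv Y\<close> and the
  inverse of the mean into the same form, with \<open>adj S\<close> for \<open>T\<close> and
  \<open>1 / a i\<close> for \<open>a i\<close>. The mean of the inverses is defined through its own
  diagonalisation; maximality bounds it without comparing the two congruences, and gives the
  direction that (ii) uses.\<close>

lemma gmean_minv_le:
  assumes X: "X \<in> carrier_mat n n" "pd X" and Y: "Y \<in> carrier_mat n n" "pd Y"
  shows "loewner_le (gmean (minv X) (minv Y)) (minv (gmean X Y))"
proof -
  obtain T S a where T: "T \<in> carrier_mat n n" "S \<in> carrier_mat n n" "T * S = 1\<^sub>m n" "S * T = 1\<^sub>m n"
    "\<And>i. i < n \<Longrightarrow> 0 < a i" "X = T * adj T" "Y = T * rdiag n (\<lambda>i. (a i)\<^sup>2) * adj T"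
    "gmean X Y = T * rdiag n a * adj T"
    using gmean_congruence[OF assms] by blast
  have adj_inv: "adj T * adj S = 1\<^sub>m n" "adj S * adj T = 1\<^sub>m n"
    using arg_cong[OF T(4), of adj] arg_cong[OF T(3), of adj] T(1,2) by (simp_all add: adjoint_mult[of _ n n _ n])
  have inv: "minv (T * rdiag n b * adj T) = adj S * rdiag n c * S" if "\<And>i. i < n \<Longrightarrow> b i * c i = 1" for b c
  proof (rule minv_eqI[of _ n])
    have "rdiag n b * rdiag n c = 1\<^sub>m n" unfolding rdiag_mult
      by (rule eq_matI) (use that in \<open>auto simp: mat_diag_def simp del: of_real_mult\<close>)
    moreover have "(T * rdiag n b * adj T) * (adj S * rdiag n c * S) = T * rdiag n b * (adj T * adj S) * rdiag n c * S"
      using T(1,2) by (simp add: square_assoc[of _ n] del: mat_diag_diag)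
    moreover have "\<dots> = T * (rdiag n b * rdiag n c) * S"
      unfolding adj_inv using T(1,2) by (simp add: square_assoc[of _ n] del: mat_diag_diag)
    ultimately show "(T * rdiag n b * adj T) * (adj S * rdiag n c * S) = 1\<^sub>m n" using T(1-3) by simp
  qed (use T in auto)
  have X': "minv X = adj S * adj (adj S)" unfolding T(6)
    using inv[of "\<lambda>_. 1" "\<lambda>_. 1"] T(1,2) by simp
  have Y': "minv Y = adj S * rdiag n (\<lambda>i. (1 / a i)\<^sup>2) * adj (adj S)"
  proof -
    have "(a i)\<^sup>2 * (1 / a i)\<^sup>2 = 1" if "i < n" for i
      using T(5)[OF that] by (simp add: power_divide)
    thus ?thesis unfolding T(7) using inv[of "\<lambda>i. (a i)\<^sup>2" "\<lambda>i. (1 / a i)\<^sup>2"] by simp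
  qed
  have G': "minv (gmean X Y) = adj S * rdiag n (\<lambda>i. 1 / a i) * adj (adj S)"
    unfolding T(8) using inv[of a "\<lambda>i. 1 / a i"] T(5) by (simp add: less_imp_neq[symmetric])
  note mX = pd_minv[OF X] and mY = pd_minv[OF Y]
  have "psd_block n (minv X) (gmean (minv X) (minv Y)) (minv Y)"
    by (rule geometric_triple_psd_block[OF gmean_geometric_triple[OF mX(1,2) mY(1,2)]])
  thus ?thesis unfolding G'
    by (rule psd_block_maximal[OF _ gmean_carrier(2)[OF mX(1,2) mY(1,2)] _ _ adj_inv(2,1) _ X' Y'])
      (use T(1,2,5) in \<open>auto simp: less_imp_le\<close>)
qed

section \<open>Positive multilinear maps\<close>

lemma smult_one_mat [simp]: "(1::complex) \<cdot>\<^sub>m A = A"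
  by (rule eq_matI) auto

locale positive_multilinear =
  fixes n m k :: nat and \<Phi> :: "(nat \<Rightarrow> complex mat) \<Rightarrow> complex mat"
  assumes multilinear: "multilinear_map n m k \<Phi>" and positive: "positive_map n k \<Phi>"
begin

lemma cong: "(\<And>i. i < k \<Longrightarrow> A i = B i) \<Longrightarrow> \<Phi> A = \<Phi> B"
  using multilinear unfolding multilinear_map_def by blast

lemma carrier: "(\<And>i. i < k \<Longrightarrow> A i \<in> carrier_mat n n) \<Longrightarrow> \<Phi> A \<in> carrier_mat m m"
  using multilinear unfolding multilinear_map_def by blast

lemma additive:
  assumes "\<And>j. j < k \<Longrightarrow> A j \<in> carrier_mat n n" "i < k" "X \<in> carrier_mat n n" "Y \<in> carrier_mat n n"
  shows "\<Phi> (A(i := X + Y)) = \<Phi> (A(i := X)) + \<Phi> (A(i := Y))"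
  using multilinear assms unfolding multilinear_map_def by blast

lemma homogeneous:
  assumes "\<And>j. j < k \<Longrightarrow> A j \<in> carrier_mat n n" "i < k" "X \<in> carrier_mat n n"
  shows "\<Phi> (A(i := c \<cdot>\<^sub>m X)) = c \<cdot>\<^sub>m \<Phi> (A(i := X))"
  using multilinear assms unfolding multilinear_map_def by blast

lemma psd_map:
  assumes "\<And>i. i < k \<Longrightarrow> A i \<in> carrier_mat n n" "\<And>i. i < k \<Longrightarrow> psd (A i)"
  shows "psd (\<Phi> A)"
  using positive assms unfolding positive_map_def by blast

lemma map_zero:
  assumes A: "\<And>j. j < k \<Longrightarrow> A j \<in> carrier_mat n n" and i: "i < k"
  shows "\<Phi> (A(i := 0\<^sub>m n n)) = 0\<^sub>m m m"
proof -
  have "(0::complex) \<cdot>\<^sub>m 0\<^sub>m n n = 0\<^sub>m n n" by (rule eq_matI) auto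
  hence "\<Phi> (A(i := 0\<^sub>m n n)) = 0 \<cdot>\<^sub>m \<Phi> (A(i := 0\<^sub>m n n))"
    using homogeneous[of A i "0\<^sub>m n n" 0] A i by simp
  moreover have "\<Phi> (A(i := 0\<^sub>m n n)) \<in> carrier_mat m m" using A by (intro carrier) auto
  hence "0 \<cdot>\<^sub>m \<Phi> (A(i := 0\<^sub>m n n)) = 0\<^sub>m m m" by (intro eq_matI) auto
  ultimately show ?thesis by simp
qed

lemma scale:
  assumes A: "\<And>j. j < k \<Longrightarrow> A j \<in> carrier_mat n n" and r: "r \<le> k"
  shows "\<Phi> (\<lambda>i. if i < r then complex_of_real (a i) \<cdot>\<^sub>m A i else A i) = complex_of_real (\<Prod>i<r. a i) \<cdot>\<^sub>m \<Phi> A"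
  using r
proof (induction r)
  case 0
  then show ?case by simp
next
  case (Suc r)
  define C where "C = (\<lambda>i. if i < r then complex_of_real (a i) \<cdot>\<^sub>m A i else A i)"
  have C: "\<And>j. j < k \<Longrightarrow> C j \<in> carrier_mat n n" unfolding C_def using A by auto
  have "(\<lambda>i. if i < Suc r then complex_of_real (a i) \<cdot>\<^sub>m A i else A i) = C(r := complex_of_real (a r) \<cdot>\<^sub>m A r)"
    unfolding C_def by (auto simp: fun_eq_iff less_Suc_eq)
  moreover have "C(r := A r) = C" unfolding C_def by (auto simp: fun_eq_iff)
  ultimately have "\<Phi> (\<lambda>i. if i < Suc r then complex_of_real (a i) \<cdot>\<^sub>m A i else A i) = complex_of_real (a r) \<cdot>\<^sub>m \<Phi> C"
    using homogeneous[of C r "A r" "complex_of_real (a r)"] C A Suc.prems by simp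
  also have "\<Phi> C = complex_of_real (\<Prod>i<r. a i) \<cdot>\<^sub>m \<Phi> A" unfolding C_def using Suc by simp
  finally show ?case using carrier[OF A] by (intro eq_matI) auto
qed

text \<open>The first \<open>r\<close> arguments are general triples, the remaining ones consist of a single summand, so that
  the induction on \<open>r\<close> splits off the summands of one argument at a time.\<close>
lemma psd_block_map_aux:
  assumes "r \<le> k" "\<And>i. i < r \<Longrightarrow> geometric_triple n (X i) (Z i) (Y i)"
    "\<And>i. r \<le> i \<Longrightarrow> i < k \<Longrightarrow> S i \<in> carrier_mat n n \<and> psd (S i) \<and> 0 \<le> a i \<and> X i = S i \<and>
       Z i = complex_of_real (a i) \<cdot>\<^sub>m S i \<and> Y i = complex_of_real ((a i)\<^sup>2) \<cdot>\<^sub>m S i"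
  shows "psd_block m (\<Phi> X) (\<Phi> Z) (\<Phi> Y)"
  using assms
proof (induction r arbitrary: X Z Y S a)
  case 0
  note S = "0.prems"(3)[OF le0]
  have c: "\<Phi> S \<in> carrier_mat m m" "psd (\<Phi> S)" using S by (auto intro: carrier psd_map)
  have "\<Phi> X = \<Phi> S" using S by (intro cong) auto
  moreover have "\<Phi> Z = \<Phi> (\<lambda>i. if i < k then complex_of_real (a i) \<cdot>\<^sub>m S i else S i)"
    using S by (intro cong) auto
  hence "\<Phi> Z = complex_of_real (\<Prod>i<k. a i) \<cdot>\<^sub>m \<Phi> S" using scale[of S k a] S by simp
  moreover have "\<Phi> Y = \<Phi> (\<lambda>i. if i < k then complex_of_real ((a i)\<^sup>2) \<cdot>\<^sub>m S i else S i)"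
    using S by (intro cong) auto
  \<comment> \<open>The product of the squares is the square of the product, so the image triple is
    again of the form (S, p S, p^2 S).\<close>
  hence "\<Phi> Y = complex_of_real ((\<Prod>i<k. a i)\<^sup>2) \<cdot>\<^sub>m \<Phi> S"
    using scale[of S k "\<lambda>i. (a i)\<^sup>2"] S by (simp add: prod_power_distrib)
  ultimately show ?case using psd_block_geometric[OF c, of "\<Prod>i<k. a i"] by simp
next
  case (Suc r)
  have r: "r < k" "r \<le> k" using Suc.prems(1) by auto
  have c: "X j \<in> carrier_mat n n" "Z j \<in> carrier_mat n n" "Y j \<in> carrier_mat n n" if "j < k" for j
  proof -
    have "X j \<in> carrier_mat n n \<and> Z j \<in> carrier_mat n n \<and> Y j \<in> carrier_mat n n"
    proof (cases "j < Suc r")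
      case True
      then show ?thesis using geometric_triple_psd[OF Suc.prems(2)] by blast
    next
      case False
      then show ?thesis using Suc.prems(3)[of j] that by auto
    qed
    thus "X j \<in> carrier_mat n n" "Z j \<in> carrier_mat n n" "Y j \<in> carrier_mat n n" by auto
  qed
  \<comment> \<open>Only slot \<open>r\<close> varies, by induction over its summands. A single
    summand \<open>P\<close> with coefficient \<open>b\<close> falls under the outer hypothesis once
    it is recorded in slot \<open>r\<close> of \<open>S\<close> and \<open>a\<close>.\<close>
  have "psd_block m (\<Phi> (X(r := x))) (\<Phi> (Z(r := z))) (\<Phi> (Y(r := y)))" if "geometric_triple n x z y" for x z y
    using that
  proof induction
    case zero
    then show ?case using map_zero[of X r] map_zero[of Z r] map_zero[of Y r] c r(1) psd_block_zero
      by (simp del: fun_upd_apply)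
  next
    case (add x z y P b)
    note xyz = geometric_triple_psd[OF add.hyps(1)]
    have "psd_block m (\<Phi> (X(r := P))) (\<Phi> (Z(r := complex_of_real b \<cdot>\<^sub>m P))) (\<Phi> (Y(r := complex_of_real (b\<^sup>2) \<cdot>\<^sub>m P)))"
      using Suc.prems(2,3) add.hyps r by (intro Suc.IH[where S = "S(r := P)" and a = "a(r := b)"]) auto
    from psd_block_add[OF add.IH this] show ?case
      using additive[of X r x P] additive[of Z r z "complex_of_real b \<cdot>\<^sub>m P"]
        additive[of Y r y "complex_of_real (b\<^sup>2) \<cdot>\<^sub>m P"] c r(1) xyz add.hyps(2)
      by (simp del: of_real_power fun_upd_apply)
  qed
  from this[OF Suc.prems(2)[of r]] show ?case by simp
qed

lemma psd_block_map:
  assumes "\<And>i. i < k \<Longrightarrow> geometric_triple n (X i) (Z i) (Y i)"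
  shows "psd_block m (\<Phi> X) (\<Phi> Z) (\<Phi> Y)"
  using assms by (intro psd_block_map_aux[of k]) auto

text \<open>Changing \<open>Z\<close> into \<open>W\<close> one slot at a time, each decrement is
  \<Phi> at \<open>Z r - W r\<close> in slot \<open>r\<close> and entries of \<open>W\<close> or
  \<open>Z\<close> elsewhere. It is positive because the \<open>W i\<close>, and with them the
  \<open>Z i\<close>, are positive semidefinite; for merely hermitian tuples monotonicity can
  fail.\<close>

lemma mono_map:
  assumes W: "\<And>i. i < k \<Longrightarrow> W i \<in> carrier_mat n n" "\<And>i. i < k \<Longrightarrow> psd (W i)"
    and Z: "\<And>i. i < k \<Longrightarrow> Z i \<in> carrier_mat n n" and le: "\<And>i. i < k \<Longrightarrow> loewner_le (W i) (Z i)"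
  shows "loewner_le (\<Phi> W) (\<Phi> Z)"
proof -
  have d: "Z i - W i \<in> carrier_mat n n" "psd (Z i - W i)" "W i + (Z i - W i) = Z i" if "i < k" for i
    using W[OF that] Z[OF that] le[OF that] unfolding loewner_le_def by (auto intro!: eq_matI simp: minus_carrier_mat)
  have Zp: "psd (Z i)" if "i < k" for i
    using psd_add[OF W(1)[OF that] d(1)[OF that] W(2)[OF that] d(2)[OF that]] d(3)[OF that] by simp
  define M where "M r = (\<lambda>i. if i < r then W i else Z i)" for r
  have M: "M r i \<in> carrier_mat n n" "psd (M r i)" if "i < k" for r i
    unfolding M_def using that W Z Zp by auto
  have MC: "\<Phi> (M r) \<in> carrier_mat m m" "hermitian (\<Phi> (M r))" for r
    using M by (auto intro!: carrier psd_hermitian psd_map)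
  have step: "loewner_le (\<Phi> (M (Suc r))) (\<Phi> (M r))" if r: "r < k" for r
  proof -
    have e: "M r = (M r)(r := W r + (Z r - W r))" "M (Suc r) = (M r)(r := W r)"
      using d(3)[OF r] unfolding M_def by (auto simp: fun_eq_iff)
    have "\<Phi> (M r) = \<Phi> (M (Suc r)) + \<Phi> ((M r)(r := Z r - W r))"
      by (subst e(1), subst e(2)) (use M r W d in \<open>intro additive, auto\<close>)
    moreover have "\<Phi> ((M r)(r := Z r - W r)) \<in> carrier_mat m m" "psd (\<Phi> ((M r)(r := Z r - W r)))"
      using M d r by (auto intro!: carrier psd_map)
    ultimately have "\<Phi> (M r) - \<Phi> (M (Suc r)) = \<Phi> ((M r)(r := Z r - W r))" "psd (\<Phi> ((M r)(r := Z r - W r)))"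
      using MC(1)[of "Suc r"] by (auto intro!: eq_matI)
    thus ?thesis using MC[of r] MC[of "Suc r"] unfolding loewner_le_def by auto
  qed
  have "loewner_le (\<Phi> (M r)) (\<Phi> (M 0))" if "r \<le> k" for r
    using that
  proof (induction r)
    case 0
    then show ?case using MC[of 0] by (intro loewner_leI[of _ m]) auto
  next
    case (Suc r)
    then show ?case
      using loewner_le_trans[OF MC(1) MC(1) MC(1) MC(2) MC(2) step[of r], of 0] by simp
  qed
  from this[of k] have "loewner_le (\<Phi> (M k)) (\<Phi> (M 0))" by simp
  moreover have "\<Phi> (M k) = \<Phi> W" "\<Phi> (M 0) = \<Phi> Z" unfolding M_def by (auto intro: cong)
  ultimately show ?thesis by simp
qed

end

section \<open>Operator log-convex functions\<close>

lemma mfun_scalar: "mfun f (rdiag 1 (\<lambda>_. x)) = rdiag 1 (\<lambda>_. f x)"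
  using mfun_diagonalised[of "1\<^sub>m 1" 1 "rdiag 1 (\<lambda>_. x)" "\<lambda>_. x" f] by (simp add: unitaryI[of _ 1] del: One_nat_def)

text \<open>The order in \<open>op_log_convex\<close> ranges over all dimensions, and dimension 1
  gives the scalar inequality f((x + y) / 2)^2 \<le> f(x) f(y), taken here at a zero.\<close>

lemma op_log_convex_midpoint_zero:
  assumes f: "op_log_convex f" and "0 < x" "0 < y" "f x = 0"
  shows "f ((x + y) / 2) \<le> 0"
proof -
  let ?D = "\<lambda>x. rdiag 1 (\<lambda>_. x)"
  have pd: "pd (?D x)" if "0 < x" for x
    using pd_diagonalised[of "1\<^sub>m 1" 1 "\<lambda>_. x"] that by (simp add: unitaryI[of _ 1] del: One_nat_def)
  have "loewner_le (mfun f (amean (?D x) (?D y))) (gmean (mfun f (?D x)) (mfun f (?D y)))"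
    using f pd assms(2,3) unfolding op_log_convex_def by (metis mat_diag_dim)
  moreover have mean: "amean (?D x) (?D y) = ?D ((x + y) / 2)"
    unfolding amean_def by (rule eq_matI) (auto simp: mat_diag_def)
  \<comment> \<open>The outer factors are the square root of the zero matrix and annihilate the
    product, whatever the inner negative power evaluates to.\<close>
  moreover have gm: "gmean (?D 0) (?D y) = ?D 0" for y
    unfolding gmean_def mfun_scalar using mfun_scalar[of sqrt 0] by (simp del: One_nat_def)
  ultimately have "loewner_le (?D (f ((x + y) / 2))) (?D 0)"
    unfolding mean mfun_scalar assms(4) gm by blast
  from loewner_leD[OF _ _ this, of 1 "unit_vec 1 0"] show ?thesis
    by (simp add: scalar_prod_def mat_diag_def)
qed

text \<open>A zero at \<open>x\<close> forces zeros on \<open>(x/2, \<infinity>)\<close>; iterating reaches every positive real.\<close>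
lemma op_log_convex_zero:
  assumes f: "op_log_convex f" and nonneg: "\<And>x. 0 < x \<Longrightarrow> 0 \<le> f x" and x: "0 < x" "f x = 0" and y: "0 < y"
  shows "f y = 0"
proof -
  \<comment> \<open>\<open>z\<close> is the midpoint of \<open>x\<close> and
    \<open>2 * z - x\<close>, and the latter is positive exactly when \<open>z\<close> exceeds
    \<open>x / 2\<close>.\<close>
  have half: "f z = 0" if "0 < x" "f x = 0" "x / 2 < z" for x z
    using op_log_convex_midpoint_zero[OF f that(1) _ that(2), of "2 * z - x"] nonneg[of z] that by simp
  \<comment> \<open>Any ratio strictly between 1/2 and 1 would do: each point must exceed half of
    its predecessor while the sequence tends to 0.\<close>
  have pow: "f (x * (2/3)^N) = 0" for N
  proof (induction N)
    case (Suc N)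
    show ?case by (rule half[OF _ Suc]) (use x in auto)
  qed (use x in simp)
  obtain N where "(2/3 :: real) ^ N < 2 * y / x"
    using real_arch_pow_inv[of "2 * y / x" "2/3"] x y by auto
  hence "x * (2/3)^N / 2 < y" using x by (simp add: field_simps)
  thus ?thesis using half[OF _ pow[of N]] x by simp
qed

lemma pd_convex_combination:
  assumes "A \<in> carrier_mat n n" "B \<in> carrier_mat n n" "pd A" "pd B" "0 \<le> a" "0 \<le> b" "a + b = (1::real)"
  shows "pd (complex_of_real a \<cdot>\<^sub>m A + complex_of_real b \<cdot>\<^sub>m B)"
proof (rule pdI[of _ n])
  show "hermitian (complex_of_real a \<cdot>\<^sub>m A + complex_of_real b \<cdot>\<^sub>m B)"
    using assms by (intro hermitian_add[of _ n] hermitian_smult[of _ n] pd_hermitian) auto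
  fix v :: "complex Matrix.vec" assume v: "v \<in> carrier_vec n" "v \<noteq> 0\<^sub>v n"
  have p: "0 < Re ((A *\<^sub>v v) \<bullet>c v)" "0 < Re ((B *\<^sub>v v) \<bullet>c v)" using pdD v assms by auto
  have "0 < a * Re ((A *\<^sub>v v) \<bullet>c v) + b * Re ((B *\<^sub>v v) \<bullet>c v)"
  proof (cases "a = 0")
    case False
    then show ?thesis using p assms(5,6) by (intro add_pos_nonneg mult_pos_pos mult_nonneg_nonneg) auto
  qed (use p assms in auto)
  thus "0 < Re (((complex_of_real a \<cdot>\<^sub>m A + complex_of_real b \<cdot>\<^sub>m B) *\<^sub>v v) \<bullet>c v)"
    using assms(1,2) v by (simp add: quadratic_form_add[of _ n] quadratic_form_smult[of _ n])
qed (use assms in auto)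

lemma amean_convex:
  assumes "A \<in> carrier_mat n n" "B \<in> carrier_mat n n"
  shows "amean A B = complex_of_real (1/2) \<cdot>\<^sub>m A + complex_of_real (1/2) \<cdot>\<^sub>m B"
  unfolding amean_def by (rule eq_matI) (use assms in auto)

lemma amean_pd:
  assumes "A \<in> carrier_mat n n" "B \<in> carrier_mat n n" "pd A" "pd B"
  shows "amean A B \<in> carrier_mat n n" "pd (amean A B)"
  using pd_convex_combination[OF assms, of "1/2" "1/2"] assms unfolding amean_convex[OF assms(1,2)] by auto

text \<open>\<open>Z\<close> is existential to cover both cases: the mean when \<open>f\<close> is
  positive throughout, and the zero matrix when \<open>f\<close> has a zero and so vanishes on (0,
  infinity), where \<open>gmean\<close> would be applied to singular matrices.\<close>

lemma op_log_convex_triple: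
  assumes f: "op_log_convex f" and nonneg: "\<And>x. 0 < x \<Longrightarrow> 0 \<le> f x"
    and A: "A \<in> carrier_mat n n" "pd A" and B: "B \<in> carrier_mat n n" "pd B"
  shows "\<exists>Z. geometric_triple n (mfun f A) Z (mfun f B) \<and> loewner_le (mfun f (amean A B)) Z"
proof (cases "\<exists>x>0. f x = 0")
  case True
  then obtain x where x: "0 < x" "f x = 0" by auto
  have z: "mfun f M = 0\<^sub>m n n" if M: "M \<in> carrier_mat n n" "pd M" for M
  proof -
    obtain U d where U: "U \<in> carrier_mat n n" "unitary U" "M = U * rdiag n d * adj U" "\<And>i. i < n \<Longrightarrow> 0 < d i"
      using pd_spectral[OF M] by blast
    have "rdiag n (\<lambda>i. f (d i)) = 0\<^sub>m n n"
      using op_log_convex_zero[OF f nonneg x U(4)] by (intro eq_matI) (auto simp: mat_diag_def)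
    thus ?thesis unfolding mfun_diagonalised[OF U(1-3)] using U(1)
      by (simp add: right_mult_zero_mat[of _ n n] left_mult_zero_mat[of _ n n])
  qed
  have "loewner_le (0\<^sub>m n n) (0\<^sub>m n n)"
    using psd_hermitian[OF psd_zero] by (intro loewner_leI[of _ n]) auto
  thus ?thesis using z[OF A] z[OF B] z[OF amean_pd[OF A(1) B(1) A(2) B(2)]] geometric_triple.zero[of n] by auto
next
  case False
  hence pos: "\<And>x. 0 < x \<Longrightarrow> 0 < f x" using nonneg by (metis order_le_less)
  have "geometric_triple n (mfun f A) (gmean (mfun f A) (mfun f B)) (mfun f B)"
    using A B pos by (intro gmean_geometric_triple mfun_carrier mfun_pd pd_hermitian)
  moreover have "loewner_le (mfun f (amean A B)) (gmean (mfun f A) (mfun f B))"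
    using f A B unfolding op_log_convex_def by blast
  ultimately show ?thesis by blast
qed

section \<open>Trace inequalities\<close>

lemma mtrace_mult_commute:
  assumes "A \<in> carrier_mat n n" "B \<in> carrier_mat n n"
  shows "mtrace (A * B) = mtrace (B * A)"
proof -
  have "mtrace (A * B) = (\<Sum>i<n. \<Sum>j<n. A $$ (i,j) * B $$ (j,i))"
    unfolding mtrace_def using assms by (auto simp: scalar_prod_def lessThan_atLeast0 intro!: sum.cong)
  also have "\<dots> = (\<Sum>j<n. \<Sum>i<n. A $$ (i,j) * B $$ (j,i))" by (rule sum.swap)
  also have "\<dots> = mtrace (B * A)"
    unfolding mtrace_def using assms by (auto simp: scalar_prod_def lessThan_atLeast0 mult.commute intro!: sum.cong)
  finally show ?thesis .
qed

lemma mtrace_diagonalised: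
  assumes "U \<in> carrier_mat n n" "unitary U"
  shows "Re (mtrace (U * rdiag n d * adj U)) = (\<Sum>i<n. d i)"
proof -
  have "mtrace (U * rdiag n d * adj U) = mtrace (adj U * (U * rdiag n d))"
    using assms by (intro mtrace_mult_commute[of _ n]) auto
  also have "adj U * (U * rdiag n d) = adj U * U * rdiag n d"
    using assms by (intro square_assoc[symmetric, of _ n]) auto
  also have "\<dots> = rdiag n d" using assms by (simp add: unitary_right_inverse)
  finally show ?thesis by (simp add: mtrace_def mat_diag_def)
qed

lemma unitary_isometry:
  assumes "U \<in> carrier_mat n n" "unitary U" "v \<in> carrier_vec n"
  shows "(\<Sum>i<n. (cmod ((adj U *\<^sub>v v) $ i))\<^sup>2) = Re (v \<bullet>c v)"
proof -
  have "Re (v \<bullet>c v) = Re (((U * rdiag n (\<lambda>_. 1) * adj U) *\<^sub>v v) \<bullet>c v)"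
    using assms by (simp add: unitary_right_inverse)
  also have "\<dots> = (\<Sum>i<n. (cmod ((adj U *\<^sub>v v) $ i))\<^sup>2)"
    using assms by (subst quadratic_form_conj_rdiag) (auto simp del: index_mult_mat_vec)
  finally show ?thesis by simp
qed

lemma unitary_col_norm:
  assumes "U \<in> carrier_mat n n" "unitary U" "j < n"
  shows "Re (col U j \<bullet>c col U j) = 1"
  using quadratic_form_diagonalised_col[OF assms, of "\<lambda>_. 1"] assms by (simp add: unitary_right_inverse)

lemma unitary_doubly_stochastic:
  assumes Q: "Q \<in> carrier_mat n n" "unitary Q" and j: "j < n"
  shows "(\<Sum>i<n. (cmod (Q $$ (i,j)))\<^sup>2) = 1" "(\<Sum>i<n. (cmod (Q $$ (j,i)))\<^sup>2) = 1"
proof -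
  have *: "(\<Sum>i<n. (cmod (Q $$ (i,j)))\<^sup>2) = 1" if Q: "Q \<in> carrier_mat n n" "unitary Q" for Q
    using unitary_col_norm[OF Q j] cscalar_self[of "col Q j" n] Q(1) j by simp
  show "(\<Sum>i<n. (cmod (Q $$ (i,j)))\<^sup>2) = 1" by (rule *[OF Q])
  show "(\<Sum>i<n. (cmod (Q $$ (j,i)))\<^sup>2) = 1"
    using *[OF adjoint_carrier[OF Q(1)] unitary_adjoint[OF Q(2,1)]] Q(1) j by simp
qed

text \<open>The form of \<open>X\<close> at column \<open>j\<close> of \<open>V\<close> averages the
  eigenvalues of \<open>X\<close> with weights |Q_ij|^2, a doubly stochastic matrix. Column sums 1
  permit Jensen for each \<open>j\<close>; row sums 1 collapse the total to the trace.\<close>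

lemma peierls:
  assumes X: "X \<in> carrier_mat n n" "psd X" and V: "V \<in> carrier_mat n n" "unitary V" and h: "convex_on {0..} h"
  shows "(\<Sum>j<n. h (Re ((X *\<^sub>v col V j) \<bullet>c col V j))) \<le> Re (mtrace (mfun h X))"
proof -
  obtain U d where U: "U \<in> carrier_mat n n" "unitary U" "X = U * rdiag n d * adj U" "\<And>i. i < n \<Longrightarrow> 0 \<le> d i"
    using psd_spectral[OF X] by blast
  define Q where "Q = adj U * V"
  have Q: "Q \<in> carrier_mat n n" "unitary Q"
    unfolding Q_def using U V by (auto intro: unitary_mult[of _ n] unitary_adjoint[of _ n])
  define w where "w i j = (cmod (Q $$ (i,j)))\<^sup>2" for i j
  have form: "Re ((X *\<^sub>v col V j) \<bullet>c col V j) = (\<Sum>i<n. w i j * d i)" if j: "j < n" for j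
  proof -
    have "adj U *\<^sub>v col V j = col Q j" unfolding Q_def using U V j by (simp add: col_mult2[of _ n n _ n])
    thus ?thesis unfolding U(3) using U(1) V(1) Q(1) j
      by (subst quadratic_form_conj_rdiag) (auto simp: w_def mult.commute simp del: index_mult_mat_vec)
  qed
  have jensen: "h (\<Sum>i<n. w i j * d i) \<le> (\<Sum>i<n. w i j * h (d i))" if j: "j < n" for j
    using convex_on_sum[of "{..<n}" "{0..}" h "\<lambda>i. w i j" d] unitary_doubly_stochastic(1)[OF Q j] h U(4) j
    by (auto simp: w_def)
  have "(\<Sum>j<n. h (Re ((X *\<^sub>v col V j) \<bullet>c col V j))) \<le> (\<Sum>j<n. \<Sum>i<n. w i j * h (d i))"
    by (intro sum_mono) (auto simp: form intro: jensen)
  also have "\<dots> = (\<Sum>i<n. (\<Sum>j<n. w i j) * h (d i))"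
    unfolding sum_distrib_right by (rule sum.swap)
  also have "\<dots> = (\<Sum>i<n. h (d i))"
    using unitary_doubly_stochastic(2)[OF Q] by (intro sum.cong) (auto simp: w_def)
  also have "\<dots> = Re (mtrace (mfun h X))"
    unfolding mfun_diagonalised[OF U(1-3)] mtrace_diagonalised[OF U(1,2)] ..
  finally show ?thesis .
qed

text \<open>In an eigenbasis of \<open>P\<close> the trace of h(P) is exactly the sum of
  \<open>h\<close> over the diagonal of \<open>P\<close>, while Peierls bounds the traces for
  \<open>X\<close> and \<open>Y\<close> below by their diagonal sums. The claim thus reduces to the
  scalar one, where monotonicity precedes convexity.\<close>

lemma trace_midpoint:
  assumes P: "P \<in> carrier_mat n n" "psd P" and X: "X \<in> carrier_mat n n" "psd X" and Y: "Y \<in> carrier_mat n n" "psd Y"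
    and le: "\<And>v. v \<in> carrier_vec n \<Longrightarrow> 2 * Re ((P *\<^sub>v v) \<bullet>c v) \<le> Re ((X *\<^sub>v v) \<bullet>c v) + Re ((Y *\<^sub>v v) \<bullet>c v)"
    and h: "convex_on {0..} h" "mono_on {0..} h"
  shows "2 * Re (mtrace (mfun h P)) \<le> Re (mtrace (mfun h X)) + Re (mtrace (mfun h Y))"
proof -
  obtain V p where V: "V \<in> carrier_mat n n" "unitary V" "P = V * rdiag n p * adj V" "\<And>i. i < n \<Longrightarrow> 0 \<le> p i"
    using psd_spectral[OF P] by blast
  define x where "x j = Re ((X *\<^sub>v col V j) \<bullet>c col V j)" for j
  define y where "y j = Re ((Y *\<^sub>v col V j) \<bullet>c col V j)" for j
  have "2 * h (p j) \<le> h (x j) + h (y j)" if j: "j < n" for j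
  proof -
    have v: "col V j \<in> carrier_vec n" using V(1) by simp
    have xy: "0 \<le> x j" "0 \<le> y j" unfolding x_def y_def using psdD X Y v by auto
    have "p j \<le> (1 - 1/2) *\<^sub>R x j + (1/2) *\<^sub>R y j"
      using le[OF v] quadratic_form_diagonalised_col[OF V(1,2) j, of p] unfolding x_def y_def V(3) by simp
    hence "h (p j) \<le> h ((1 - 1/2) *\<^sub>R x j + (1/2) *\<^sub>R y j)"
      using V(4)[OF j] by (intro mono_onD[OF h(2)]) auto
    also have "\<dots> \<le> (1 - 1/2) * h (x j) + (1/2) * h (y j)"
      using xy by (intro convex_onD[OF h(1)]) auto
    finally show ?thesis by simp
  qed
  hence "(\<Sum>j<n. 2 * h (p j)) \<le> (\<Sum>j<n. h (x j) + h (y j))" by (intro sum_mono) auto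
  also have "\<dots> \<le> Re (mtrace (mfun h X)) + Re (mtrace (mfun h Y))"
    using peierls[OF X V(1,2) h(1)] peierls[OF Y V(1,2) h(1)] unfolding sum.distrib x_def y_def by simp
  finally show ?thesis
    unfolding mfun_diagonalised[OF V(1-3)] mtrace_diagonalised[OF V(1,2)] by (simp add: sum_distrib_left)
qed

section \<open>Boundedness along segments and the upgrade from midpoint convexity\<close>

lemma pd_form_bounds:
  assumes A: "A \<in> carrier_mat n n" "pd A"
  obtains a b where "0 < a" "\<And>v. v \<in> carrier_vec n \<Longrightarrow> a * Re (v \<bullet>c v) \<le> Re ((A *\<^sub>v v) \<bullet>c v)"
    "\<And>v. v \<in> carrier_vec n \<Longrightarrow> Re ((A *\<^sub>v v) \<bullet>c v) \<le> b * Re (v \<bullet>c v)"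
proof -
  obtain U d where U: "U \<in> carrier_mat n n" "unitary U" "A = U * rdiag n d * adj U" "\<And>i. i < n \<Longrightarrow> 0 < d i"
    using pd_spectral[OF A] by blast
  \<comment> \<open>Inserting 1 keeps the set nonempty when \<open>n\<close> is 0.\<close>
  define a where "a = Min (insert 1 (d ` {..<n}))"
  define b where "b = Max (insert 1 (d ` {..<n}))"
  have ab: "a \<le> d i" "d i \<le> b" if "i < n" for i unfolding a_def b_def using that by auto
  have "0 < a" unfolding a_def using U(4) by (subst Min_gr_iff) auto
  moreover have "a * Re (v \<bullet>c v) \<le> Re ((A *\<^sub>v v) \<bullet>c v)" "Re ((A *\<^sub>v v) \<bullet>c v) \<le> b * Re (v \<bullet>c v)"
    if v: "v \<in> carrier_vec n" for v
    unfolding U(3) quadratic_form_conj_rdiag[OF U(1) v] unitary_isometry[OF U(1,2) v, symmetric] sum_distrib_left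
    using ab by (auto intro!: sum_mono mult_right_mono simp del: index_mult_mat_vec)
  ultimately show ?thesis using that by blast
qed

text \<open>An eigenvalue at a point of the segment is the convex combination of the forms of
  \<open>A\<close> and \<open>B\<close> at its unit eigenvector. All these spectra therefore lie in
  one compact interval inside (0, infinity), on which \<open>f\<close> is bounded.\<close>

lemma mfun_segment_bounded:
  assumes A: "A \<in> carrier_mat n n" "pd A" and B: "B \<in> carrier_mat n n" "pd B" and f: "continuous_on {0<..} f"
  shows "\<exists>M\<ge>0. \<forall>t\<in>{0..1}. loewner_le (mfun f (complex_of_real (1 - t) \<cdot>\<^sub>m A + complex_of_real t \<cdot>\<^sub>m B))
           (complex_of_real M \<cdot>\<^sub>m 1\<^sub>m n)"
proof -
  obtain a b where ab: "0 < a" "\<And>v. v \<in> carrier_vec n \<Longrightarrow> a * Re (v \<bullet>c v) \<le> Re ((A *\<^sub>v v) \<bullet>c v)"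
    "\<And>v. v \<in> carrier_vec n \<Longrightarrow> Re ((A *\<^sub>v v) \<bullet>c v) \<le> b * Re (v \<bullet>c v)"
    using pd_form_bounds[OF A] by blast
  obtain a' b' where ab': "0 < a'" "\<And>v. v \<in> carrier_vec n \<Longrightarrow> a' * Re (v \<bullet>c v) \<le> Re ((B *\<^sub>v v) \<bullet>c v)"
    "\<And>v. v \<in> carrier_vec n \<Longrightarrow> Re ((B *\<^sub>v v) \<bullet>c v) \<le> b' * Re (v \<bullet>c v)"
    using pd_form_bounds[OF B] by blast
  have "compact (f ` {min a a'..max b b'})"
    using ab(1) ab'(1) by (intro compact_continuous_image continuous_on_subset[OF f]) auto
  then obtain M where M: "\<And>x. x \<in> {min a a'..max b b'} \<Longrightarrow> \<bar>f x\<bar> \<le> M"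
    using compact_imp_bounded bounded_real by (metis imageI)
  have "loewner_le (mfun f (complex_of_real (1 - t) \<cdot>\<^sub>m A + complex_of_real t \<cdot>\<^sub>m B)) (complex_of_real \<bar>M\<bar> \<cdot>\<^sub>m 1\<^sub>m n)"
    if t: "t \<in> {0..1}" for t
  proof -
    define C where "C = complex_of_real (1 - t) \<cdot>\<^sub>m A + complex_of_real t \<cdot>\<^sub>m B"
    have C: "C \<in> carrier_mat n n" "pd C" unfolding C_def using A B t pd_convex_combination[of A n B "1 - t" t] by auto
    obtain U d where U: "U \<in> carrier_mat n n" "unitary U" "C = U * rdiag n d * adj U"
      using pd_spectral[OF C] by blast
    have d: "\<bar>f (d i)\<bar> \<le> M" if i: "i < n" for i
    proof (rule M)
      let ?v = "col U i"
      have v: "?v \<in> carrier_vec n" "Re (?v \<bullet>c ?v) = 1" using U(1) unitary_col_norm[OF U(1,2) i] by auto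
      have "d i = Re ((C *\<^sub>v ?v) \<bullet>c ?v)" unfolding U(3) quadratic_form_diagonalised_col[OF U(1,2) i] ..
      also have "\<dots> = (1 - t) * Re ((A *\<^sub>v ?v) \<bullet>c ?v) + t * Re ((B *\<^sub>v ?v) \<bullet>c ?v)"
        unfolding C_def using A(1) B(1) v(1) by (simp add: quadratic_form_add[of _ n] quadratic_form_smult[of _ n])
      finally have d: "d i = (1 - t) * Re ((A *\<^sub>v ?v) \<bullet>c ?v) + t * Re ((B *\<^sub>v ?v) \<bullet>c ?v)" .
      have "(1 - t) * min a a' + t * min a a' \<le> d i" "d i \<le> (1 - t) * max b b' + t * max b b'"
        unfolding d using ab(2,3)[OF v(1)] ab'(2,3)[OF v(1)] v(2) t
        by (auto intro!: add_mono mult_left_mono)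
      thus "d i \<in> {min a a'..max b b'}" by (simp add: algebra_simps)
    qed
    have "loewner_le (mfun f C) (complex_of_real \<bar>M\<bar> \<cdot>\<^sub>m 1\<^sub>m n)"
    proof (rule loewner_leI[of _ n])
      show "hermitian (complex_of_real \<bar>M\<bar> \<cdot>\<^sub>m 1\<^sub>m n)"
        by (intro hermitian_smult[of _ n] hermitianI[of _ n]) auto
      fix v :: "complex Matrix.vec" assume v: "v \<in> carrier_vec n"
      have "Re ((mfun f C *\<^sub>v v) \<bullet>c v) \<le> \<bar>M\<bar> * Re (v \<bullet>c v)"
        unfolding mfun_diagonalised[OF U] quadratic_form_conj_rdiag[OF U(1) v]
          unitary_isometry[OF U(1,2) v, symmetric] sum_distrib_left
        using d by (intro sum_mono mult_right_mono) force+
      also have "\<bar>M\<bar> * Re (v \<bullet>c v) = Re (((complex_of_real \<bar>M\<bar> \<cdot>\<^sub>m 1\<^sub>m n) *\<^sub>v v) \<bullet>c v)"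
        using v by (subst quadratic_form_smult[of _ n]) auto
      finally show "Re ((mfun f C *\<^sub>v v) \<bullet>c v) \<le> \<dots>" .
    qed (use mfun_carrier[OF C(1) pd_hermitian[OF C(2)]] in auto)
    thus ?thesis unfolding C_def .
  qed
  thus ?thesis by (intro exI[of _ "\<bar>M\<bar>"]) auto
qed

text \<open>Bernstein--Doetsch: after subtracting the chord, an upper bound \<open>C\<close> of a midpoint convex function
  improves to \<open>C/2\<close>, because every point of \<open>[0,1]\<close> is the midpoint of an endpoint and another point.\<close>
lemma midpoint_convex_bounded:
  fixes g :: "real \<Rightarrow> real"
  assumes mid: "\<And>s t. s \<in> {0..1} \<Longrightarrow> t \<in> {0..1} \<Longrightarrow> 2 * g ((s + t) / 2) \<le> g s + g t"
    and bound: "\<And>t. t \<in> {0..1} \<Longrightarrow> g t \<le> C" and t: "t \<in> {0..1}"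
  shows "g t \<le> (1 - t) * g 0 + t * g 1"
proof -
  define \<phi> where "\<phi> t = g t - ((1 - t) * g 0 + t * g 1)" for t
  have mid': "2 * \<phi> ((s + t) / 2) \<le> \<phi> s + \<phi> t" if "s \<in> {0..1}" "t \<in> {0..1}" for s t
    using mid[OF that] unfolding \<phi>_def by (simp add: field_simps)
  have ends: "\<phi> 0 = 0" "\<phi> 1 = 0" unfolding \<phi>_def by auto
  \<comment> \<open>\<open>C\<close> bounds \<open>g\<close>, and the other two terms bound the
    chord that \<phi> subtracts.\<close>
  define C' where "C' = \<bar>C\<bar> + \<bar>g 0\<bar> + \<bar>g 1\<bar>"
  have "\<phi> t \<le> C' / 2 ^ N" if "t \<in> {0..1}" for N t
    using that
  proof (induction N arbitrary: t)
    case 0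
    have "\<bar>(1 - t) * g 0\<bar> \<le> \<bar>g 0\<bar>" "\<bar>t * g 1\<bar> \<le> \<bar>g 1\<bar>"
      using 0 by (auto simp: abs_mult intro!: mult_left_le_one_le)
    then show ?case using bound[OF 0] unfolding \<phi>_def C'_def by simp
  next
    case (Suc N)
    show ?case
    proof (cases "t \<le> 1/2")
      case True
      have "\<phi> t \<le> (C' / 2 ^ N) / 2"
        using True mid'[of 0 "2 * t"] Suc.IH[of "2 * t"] Suc.prems ends by simp
      then show ?thesis by (simp add: mult.commute)
    next
      case False
      have "\<phi> t \<le> (C' / 2 ^ N) / 2"
        using False mid'[of 1 "2 * t - 1"] Suc.IH[of "2 * t - 1"] Suc.prems ends by simp
      then show ?thesis by (simp add: mult.commute)
    qed
  qed
  hence b: "\<phi> t \<le> C' / 2 ^ N" for N using t by blast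
  have "(\<lambda>N. C' / 2 ^ N) \<longlonglongrightarrow> 0"
    using tendsto_mult_left[OF LIMSEQ_power_zero[of "1/2 :: real"], of C'] by (simp add: power_divide)
  hence "\<phi> t \<le> 0" by (rule LIMSEQ_le_const) (use b in auto)
  thus ?thesis unfolding \<phi>_def by simp
qed

theorem theorem3p11:
  fixes n m k :: nat
    and \<Phi> :: "(nat \<Rightarrow> complex mat) \<Rightarrow> complex mat"
    and f :: "nat \<Rightarrow> real \<Rightarrow> real"
  assumes multilin: "multilinear_map n m k \<Phi>"
    and pos: "positive_map n k \<Phi>"
    and f_nonneg: "\<forall>i<k. \<forall>x>0. 0 \<le> f i x"
    and f_cont: "\<forall>i<k. continuous_on {0<..} (f i)"
    and f_olc: "\<forall>i<k. op_log_convex (f i)"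
  shows
    \<comment> \<open>(i) joint log-convexity of F\<close>
    "(\<forall>A B. (\<forall>i<k. A i \<in> carrier_mat n n \<and> pd (A i) \<and> B i \<in> carrier_mat n n \<and> pd (B i)) \<longrightarrow>
        pd (\<Phi> (\<lambda>i. mfun (f i) (A i))) \<longrightarrow> pd (\<Phi> (\<lambda>i. mfun (f i) (B i))) \<longrightarrow>
        loewner_le (\<Phi> (\<lambda>i. mfun (f i) (amean (A i) (B i))))
                   (gmean (\<Phi> (\<lambda>i. mfun (f i) (A i))) (\<Phi> (\<lambda>i. mfun (f i) (B i)))))
   \<and>
    \<comment> \<open>(ii) joint log-concavity of F^{-1}\<close>
    (\<forall>A B. (\<forall>i<k. A i \<in> carrier_mat n n \<and> pd (A i) \<and> B i \<in> carrier_mat n n \<and> pd (B i)) \<longrightarrow>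
        pd (\<Phi> (\<lambda>i. mfun (f i) (A i))) \<longrightarrow> pd (\<Phi> (\<lambda>i. mfun (f i) (B i))) \<longrightarrow>
        pd (\<Phi> (\<lambda>i. mfun (f i) (amean (A i) (B i)))) \<longrightarrow>
        loewner_le (gmean (minv (\<Phi> (\<lambda>i. mfun (f i) (A i)))) (minv (\<Phi> (\<lambda>i. mfun (f i) (B i)))))
                   (minv (\<Phi> (\<lambda>i. mfun (f i) (amean (A i) (B i))))))
   \<and>
    \<comment> \<open>(iii) joint convexity of Tr h(F) for convex increasing h\<close>
    (\<forall>h :: real \<Rightarrow> real. convex_on {0..} h \<longrightarrow> mono_on {0..} h \<longrightarrow>
      (\<forall>A B (t::real). (\<forall>i<k. A i \<in> carrier_mat n n \<and> pd (A i) \<and> B i \<in> carrier_mat n n \<and> pd (B i)) \<longrightarrow>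
        0 \<le> t \<longrightarrow> t \<le> 1 \<longrightarrow>
        Re (mtrace (mfun h (\<Phi> (\<lambda>i. mfun (f i)
              (complex_of_real (1 - t) \<cdot>\<^sub>m A i + complex_of_real t \<cdot>\<^sub>m B i)))))
        \<le> (1 - t) * Re (mtrace (mfun h (\<Phi> (\<lambda>i. mfun (f i) (A i)))))
          + t * Re (mtrace (mfun h (\<Phi> (\<lambda>i. mfun (f i) (B i)))))))"
proof -
  interpret positive_multilinear n m k \<Phi> using multilin pos by unfold_locales
  have nonneg: "0 \<le> f i x" if "i < k" "0 < x" for i x using f_nonneg that by blast
  have olc: "op_log_convex (f i)" if "i < k" for i using f_olc that by blast
  define F where "F A = \<Phi> (\<lambda>i. mfun (f i) (A i))" for A
  let ?ok = "\<lambda>A. \<forall>i<k. A i \<in> carrier_mat n n \<and> pd (A i)"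
  have Fpsd: "F A \<in> carrier_mat m m" "psd (F A)" if "?ok A" for A
    using that nonneg unfolding F_def by (auto intro!: carrier psd_map mfun_carrier[of _ n] mfun_psd[of _ n] pd_hermitian)
  \<comment> \<open>Common core of all three parts. An unspecified \<open>Z\<close> stands where a
    mean would, since nothing here makes \<open>F A\<close> or \<open>F B\<close>
    invertible.\<close>
  have mid: "\<exists>Z. psd_block m (F A) Z (F B) \<and> hermitian Z \<and> loewner_le (F (\<lambda>i. amean (A i) (B i))) Z"
    if A: "?ok A" and B: "?ok B" for A B
  proof -
    have "\<exists>Z. geometric_triple n (mfun (f i) (A i)) Z (mfun (f i) (B i)) \<and> loewner_le (mfun (f i) (amean (A i) (B i))) Z"
      if "i < k" for i
      using op_log_convex_triple[OF olc[OF that] nonneg[OF that]] A B that by blast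
    then obtain Z where Z: "\<And>i. i < k \<Longrightarrow> geometric_triple n (mfun (f i) (A i)) (Z i) (mfun (f i) (B i))"
      "\<And>i. i < k \<Longrightarrow> loewner_le (mfun (f i) (amean (A i) (B i))) (Z i)" by metis
    have ZC: "Z i \<in> carrier_mat n n" "psd (Z i)" if "i < k" for i using geometric_triple_psd[OF Z(1)[OF that]] by auto
    have AB: "amean (A i) (B i) \<in> carrier_mat n n" "pd (amean (A i) (B i))" if "i < k" for i
      using amean_pd[of "A i" n "B i"] A B that by auto
    have "psd_block m (F A) (\<Phi> Z) (F B)" unfolding F_def using Z(1) by (rule psd_block_map)
    moreover have "hermitian (\<Phi> Z)" using ZC by (intro psd_hermitian psd_map)
    moreover have "loewner_le (F (\<lambda>i. amean (A i) (B i))) (\<Phi> Z)"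
      unfolding F_def using AB ZC Z(2) nonneg
      by (intro mono_map) (auto intro: mfun_carrier[of _ n] mfun_psd[of _ n] pd_hermitian)
    ultimately show ?thesis by blast
  qed
  have okm: "?ok (\<lambda>i. amean (A i) (B i))" if "?ok A" "?ok B" for A B
    using amean_pd[of _ n] that by blast
  have log_convex: "loewner_le (F (\<lambda>i. amean (A i) (B i))) (gmean (F A) (F B))"
    if A: "?ok A" and B: "?ok B" and pd: "pd (F A)" "pd (F B)" for A B
  proof -
    obtain Z where Z: "psd_block m (F A) Z (F B)" "hermitian Z" "loewner_le (F (\<lambda>i. amean (A i) (B i))) Z"
      using mid[OF A B] by blast
    have "Z \<in> carrier_mat m m" using psd_block_carrier[OF Z(1)] by simp
    moreover note gm = gmean_carrier[OF Fpsd(1)[OF A] pd(1) Fpsd(1)[OF B] pd(2)]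
    ultimately show ?thesis
      using loewner_le_trans[OF Fpsd(1)[OF okm[OF A B]] _ gm(1) psd_hermitian[OF Fpsd(2)[OF okm[OF A B]]] gm(2) Z(3)
        psd_block_le_gmean[OF Z(1,2) pd]] by blast
  qed
  have inverse: "loewner_le (gmean (minv (F A)) (minv (F B))) (minv (F (\<lambda>i. amean (A i) (B i))))"
    if A: "?ok A" and B: "?ok B" and pd: "pd (F A)" "pd (F B)" "pd (F (\<lambda>i. amean (A i) (B i)))" for A B
  proof -
    note C = Fpsd(1)[OF A] Fpsd(1)[OF B] Fpsd(1)[OF okm[OF A B]]
    note gm = gmean_carrier[OF C(1) pd(1) C(2) pd(2)]
    \<comment> \<open>By (i) the mean dominates the midpoint value of \<open>F\<close>, which is
      positive definite; this makes the mean eligible for \<open>minv_antimono\<close>.\<close>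
    have gpd: "pd (gmean (F A) (F B))"
      using loewner_leD[OF C(3) gm(1) log_convex[OF A B pd(1,2)]] pdD[OF pd(3) C(3)] gm
      by (intro pdI[of _ m]) (auto intro: less_le_trans)
    note i = pd_minv[OF C(1) pd(1)] pd_minv[OF C(2) pd(2)]
    note gi = gmean_carrier[OF i(1,2) i(5,6)]
    show ?thesis
      by (rule loewner_le_trans[OF gi(1) _ _ gi(2) _ gmean_minv_le[OF C(1) pd(1) C(2) pd(2)]
            minv_antimono[OF C(3) pd(3) gm(1) gpd log_convex[OF A B pd(1,2)]]])
        (use pd_minv[OF gm(1) gpd] pd_minv[OF C(3) pd(3)] pd_hermitian in auto)
  qed
  have trace: "Re (mtrace (mfun h (F (\<lambda>i. complex_of_real (1 - t) \<cdot>\<^sub>m A i + complex_of_real t \<cdot>\<^sub>m B i))))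
      \<le> (1 - t) * Re (mtrace (mfun h (F A))) + t * Re (mtrace (mfun h (F B)))"
    if h: "convex_on {0..} h" "mono_on {0..} h" and A: "?ok A" and B: "?ok B" and t: "0 \<le> t" "t \<le> 1" for h A B t
  proof -
    define C where "C t = (\<lambda>i. complex_of_real (1 - t) \<cdot>\<^sub>m A i + complex_of_real t \<cdot>\<^sub>m B i)" for t
    define g where "g t = Re (mtrace (mfun h (F (C t))))" for t
    have AB: "dim_row (A i) = n" "dim_col (A i) = n" "dim_row (B i) = n" "dim_col (B i) = n" if "i < k" for i
      using A B that by auto
    have ok: "?ok (C t)" if "t \<in> {0..1}" for t
      using A B that using pd_convex_combination[of _ n _ "1 - t" t] unfolding C_def by (auto simp del: of_real_diff)
    have "2 * g ((s + t) / 2) \<le> g s + g t" if st: "s \<in> {0..1}" "t \<in> {0..1}" for s t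
    proof -
      have "C ((s + t) / 2) i = amean (C s i) (C t i)" if "i < k" for i
        unfolding C_def amean_def using AB[OF that]
        by (intro eq_matI) (auto simp: field_simps)
      hence "F (C ((s + t) / 2)) = F (\<lambda>i. amean (C s i) (C t i))" unfolding F_def by (intro cong) simp
      moreover obtain Z where Z: "psd_block m (F (C s)) Z (F (C t))" "hermitian Z"
        "loewner_le (F (\<lambda>i. amean (C s i) (C t i))) Z" using mid[OF ok ok] st by blast
      note D = Fpsd[OF okm[OF ok[OF st(1)] ok[OF st(2)]]]
      have "2 * Re (((F (\<lambda>i. amean (C s i) (C t i))) *\<^sub>v v) \<bullet>c v)
          \<le> Re ((F (C s) *\<^sub>v v) \<bullet>c v) + Re ((F (C t) *\<^sub>v v) \<bullet>c v)" if v: "v \<in> carrier_vec m" for v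
        using psd_block_diagonal[OF Z(1) v] loewner_leD[OF D(1) _ Z(3) v] psd_block_carrier[OF Z(1)] by auto
      ultimately show ?thesis
        unfolding g_def using trace_midpoint[OF D Fpsd[OF ok[OF st(1)]] Fpsd[OF ok[OF st(2)]] _ h] by simp
    qed
    moreover have "\<exists>K. \<forall>t\<in>{0..1}. g t \<le> K"
    proof -
      have "\<exists>M\<ge>0. \<forall>t\<in>{0..1}. loewner_le (mfun (f i) (C t i)) (complex_of_real M \<cdot>\<^sub>m 1\<^sub>m n)" if "i < k" for i
        unfolding C_def using A B f_cont that by (intro mfun_segment_bounded) auto
      then obtain M where M: "\<And>i. i < k \<Longrightarrow> 0 \<le> M i"
        "\<And>i t. i < k \<Longrightarrow> t \<in> {0..1} \<Longrightarrow> loewner_le (mfun (f i) (C t i)) (complex_of_real (M i) \<cdot>\<^sub>m 1\<^sub>m n)" by metis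
      \<comment> \<open>Monotonicity of \<Phi> places every \<open>F (C t)\<close> below this one
        matrix.\<close>
      define P where "P = \<Phi> (\<lambda>i. complex_of_real (M i) \<cdot>\<^sub>m 1\<^sub>m n)"
      have "psd (1\<^sub>m n)" using psd_conj_rdiag[of "1\<^sub>m n" n "\<lambda>_. 1"] by simp
      hence P: "P \<in> carrier_mat m m" "psd P"
        unfolding P_def using M(1) by (auto intro!: carrier psd_map psd_smult[of _ n])
      have "g t \<le> Re (mtrace (mfun h P))" if t: "t \<in> {0..1}" for t
      proof -
        note D = Fpsd[OF ok[OF t]]
        have "loewner_le (F (C t)) P"
          unfolding F_def P_def using ok[OF t] nonneg M(2) t
          by (intro mono_map) (auto intro: mfun_carrier[of _ n] mfun_psd[of _ n] pd_hermitian)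
        \<comment> \<open>With both endpoints equal to \<open>P\<close>, the midpoint inequality
          becomes monotonicity of the trace function.\<close>
        hence "2 * g t \<le> Re (mtrace (mfun h P)) + Re (mtrace (mfun h P))"
          unfolding g_def using loewner_leD[OF D(1) P(1)] by (intro trace_midpoint[OF D P P _ h]) fastforce
        thus ?thesis by simp
      qed
      thus ?thesis by blast
    qed
    then obtain K where "\<And>t. t \<in> {0..1} \<Longrightarrow> g t \<le> K" by blast
    ultimately have "g t \<le> (1 - t) * g 0 + t * g 1"
      using t by (intro midpoint_convex_bounded[of g K]) auto
    \<comment> \<open>Beyond \<open>k\<close> the dimensions are unknown and the tuples may differ,
      so the values of \<open>F\<close> are compared through \<open>cong\<close>.\<close>
    moreover have "C 0 i = A i" "C 1 i = B i" if "i < k" for i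
      unfolding C_def using AB[OF that] by (auto intro!: eq_matI)
    hence "F (C 0) = F A" "F (C 1) = F B" unfolding F_def by (auto intro!: cong)
    ultimately show ?thesis unfolding g_def C_def by simp
  qed
  show ?thesis
    using log_convex inverse trace unfolding F_def by simp
qed

end
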